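(* Let $k$ be a field of characteristic zero, let $G$ be a finite group, and let $D(kG)$ be the Drinfel'd double of the group algebra $kG$. Then \[ d(kG,D(kG))\le 2 \] if and only if $G$ is abelian.
   Context: Let $(kG)^*$ have the basis $\{p_x\}_{x\in G}$ dual to $G$, $p_x(y)=\delta_{x,y}$, with $p_xp_y=\delta_{x,y}p_x$ and identity $\varepsilon=\sum_{y\in G}p_y$. The Drinfel'd double $D(kG)=(kG)^{*cop}\bowtie kG$ is the vector space $(kG)^*\otimes kG$ with product $(p_x\bowtie g)(p_y\bowtie h)=p_xp_{gyg^{-1}}\bowtie gh$ and unit $\varepsilon\bowtie e$. $kG$ is regarded as a subalgebra via $g\mapsto\varepsilon\bowtie g$. Depth: two modules (or bimodules) $M,N$ are similar, $M\sim N$, if there are positive integers $p,q$ such that $M$ is isomorphic to a direct summand of $N^{p}$ and $N$ is isomorphic to a direct summand of $M^{q}$. For a ring extension $R\subseteq H$ put $H^{\otimes_R(0)}=R$ and $H^{\otimes_R(n)}=H\otimes_R\cdots\otimes_R H$ ($n$ factors). The extension has depth $2n+1$ ($n\ge 0$) if $H^{\otimes_R(n+1)}\sim H^{\otimes_R(n)}$ as $R$-$R$-bimodules, and depth $2n$ ($n\ge1$) if $H^{\otimes_R(n+1)}\sim H^{\otimes_R(n)}$ as $R$-$H$-bimodules or as $H$-$R$-bimodules. The minimum depth $d(R,H)$ is the least positive integer $m$ such that the extension has depth $m$ ($\infty$ if none). *)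

theory Defs
  imports
    "HOL-Library.Extended_Nat"
    "HOL-Algebra.Subrings"
    "HOL-Algebra.Free_Abelian_Groups"
begin

section \<open>Bimodules and similarity\<close>

text \<open>
  As in the library record \<^verbatim>\<open>module\<close>, only the additive part of the underlying
  \<^verbatim>\<open>ring\<close> record is meaningful.
\<close>

record ('r, 's, 'm) bimodule = "'m ring" +
  lsmult :: "'r \<Rightarrow> 'm \<Rightarrow> 'm"
  rsmult :: "'m \<Rightarrow> 's \<Rightarrow> 'm"

text \<open>
  In the following definitions the sets \<open>A\<close> and \<open>B\<close> are the (carriers of the) rings acting
  from the left and from the right. A bimodule is restricted to subrings by shrinking \<open>A\<close>
  and \<open>B\<close>.
\<close>

definition bimodule_iso ::
  "'r set \<Rightarrow> 's set \<Rightarrow> ('r, 's, 'm) bimodule \<Rightarrow> ('r, 's, 'n) bimodule \<Rightarrow> ('m \<Rightarrow> 'n) set" where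
  "bimodule_iso A B M N = {f. bij_betw f (carrier M) (carrier N) \<and>
     (\<forall>x\<in>carrier M. \<forall>y\<in>carrier M. f (x \<oplus>\<^bsub>M\<^esub> y) = f x \<oplus>\<^bsub>N\<^esub> f y) \<and>
     (\<forall>a\<in>A. \<forall>x\<in>carrier M. f (lsmult M a x) = lsmult N a (f x)) \<and>
     (\<forall>b\<in>B. \<forall>x\<in>carrier M. f (rsmult M x b) = rsmult N (f x) b)}"

definition subbimodule ::
  "'r set \<Rightarrow> 's set \<Rightarrow> 'm set \<Rightarrow> ('r, 's, 'm) bimodule \<Rightarrow> bool" where
  "subbimodule A B U M \<longleftrightarrow> subgroup U (add_monoid M) \<and>
     (\<forall>a\<in>A. \<forall>x\<in>U. lsmult M a x \<in> U) \<and> (\<forall>b\<in>B. \<forall>x\<in>U. rsmult M x b \<in> U)"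

definition direct_summand ::
  "'r set \<Rightarrow> 's set \<Rightarrow> 'm set \<Rightarrow> ('r, 's, 'm) bimodule \<Rightarrow> bool" where
  "direct_summand A B U M \<longleftrightarrow> subbimodule A B U M \<and>
     (\<exists>V. subbimodule A B V M \<and> U \<inter> V = {\<zero>\<^bsub>M\<^esub>} \<and>
          carrier M = {u \<oplus>\<^bsub>M\<^esub> v |u v. u \<in> U \<and> v \<in> V})"

definition bimodule_power ::
  "('r, 's, 'm) bimodule \<Rightarrow> nat \<Rightarrow> ('r, 's, nat \<Rightarrow> 'm) bimodule" where
  "bimodule_power M p =
     \<lparr>carrier = {..<p} \<rightarrow>\<^sub>E carrier M,
      monoid.mult = undefined, one = undefined,
      ring.zero = (\<lambda>i\<in>{..<p}. \<zero>\<^bsub>M\<^esub>),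
      ring.add = (\<lambda>x y. \<lambda>i\<in>{..<p}. x i \<oplus>\<^bsub>M\<^esub> y i),
      lsmult = (\<lambda>a x. \<lambda>i\<in>{..<p}. lsmult M a (x i)),
      rsmult = (\<lambda>x b. \<lambda>i\<in>{..<p}. rsmult M (x i) b)\<rparr>"

definition iso_to_summand_of_power ::
  "'r set \<Rightarrow> 's set \<Rightarrow> ('r, 's, 'm) bimodule \<Rightarrow> ('r, 's, 'n) bimodule \<Rightarrow> nat \<Rightarrow> bool" where
  "iso_to_summand_of_power A B M N p \<longleftrightarrow>
     (\<exists>U. direct_summand A B U (bimodule_power N p) \<and>
          bimodule_iso A B M ((bimodule_power N p)\<lparr>carrier := U\<rparr>) \<noteq> {})"

definition similar ::
  "'r set \<Rightarrow> 's set \<Rightarrow> ('r, 's, 'm) bimodule \<Rightarrow> ('r, 's, 'n) bimodule \<Rightarrow> bool" where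
  "similar A B M N \<longleftrightarrow>
     (\<exists>p>0. iso_to_summand_of_power A B M N p) \<and> (\<exists>q>0. iso_to_summand_of_power A B N M q)"


section \<open>Tensor powers of a ring extension\<close>

text \<open>
  For a subring with carrier \<open>R\<close> of a ring \<open>H\<close> and \<open>n \<ge> 1\<close>, the \<open>n\<close>-fold tensor product
  of \<open>H\<close> over \<open>R\<close> is the quotient of the free abelian group on \<open>H\<^sup>n\<close> (lists of
  length \<open>n\<close>) by the relations that make the class of \<open>[x\<^sub>1, \<dots>, x\<^sub>n]\<close>
  additive in each \<open>x\<^sub>i\<close> and \<open>R\<close>-balanced in each adjacent pair. All
  \<open>n \<ge> 1\<close> thus share one type; for \<open>n = 1\<close> the quotient is \<open>H\<close> itself by
  \<open>tensor_power_1_iso\<close>.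
\<close>

definition tensor_free :: "('h, 'b) ring_scheme \<Rightarrow> nat \<Rightarrow> ('h list \<Rightarrow>\<^sub>0 int) monoid" where
  "tensor_free H n = free_Abelian_group {xs. length xs = n \<and> set xs \<subseteq> carrier H}"

definition tensor_relators ::
  "('h, 'b) ring_scheme \<Rightarrow> 'h set \<Rightarrow> nat \<Rightarrow> ('h list \<Rightarrow>\<^sub>0 int) set" where
  "tensor_relators H R n =
     {frag_of (us @ [x \<oplus>\<^bsub>H\<^esub> y] @ vs) - frag_of (us @ [x] @ vs) - frag_of (us @ [y] @ vs) |us vs x y.
        set us \<subseteq> carrier H \<and> set vs \<subseteq> carrier H \<and> x \<in> carrier H \<and> y \<in> carrier H \<and>
        length us + 1 + length vs = n} \<union>
     {frag_of (us @ [x \<otimes>\<^bsub>H\<^esub> r, y] @ vs) - frag_of (us @ [x, r \<otimes>\<^bsub>H\<^esub> y] @ vs) |us vs x y r.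
        set us \<subseteq> carrier H \<and> set vs \<subseteq> carrier H \<and> x \<in> carrier H \<and> y \<in> carrier H \<and>
        r \<in> R \<and> length us + 2 + length vs = n}"

definition tensor_null ::
  "('h, 'b) ring_scheme \<Rightarrow> 'h set \<Rightarrow> nat \<Rightarrow> ('h list \<Rightarrow>\<^sub>0 int) set" where
  "tensor_null H R n = generate (tensor_free H n) (tensor_relators H R n)"

definition lmult_first :: "('h, 'b) ring_scheme \<Rightarrow> 'h \<Rightarrow> 'h list \<Rightarrow> 'h list" where
  "lmult_first H a xs = (a \<otimes>\<^bsub>H\<^esub> hd xs) # tl xs"

definition rmult_last :: "('h, 'b) ring_scheme \<Rightarrow> 'h \<Rightarrow> 'h list \<Rightarrow> 'h list" where
  "rmult_last H b xs = butlast xs @ [last xs \<otimes>\<^bsub>H\<^esub> b]"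

text \<open>
  An additive map \<open>f\<close> of the free abelian group that preserves the subgroup \<open>N\<close> of
  relations induces on cosets the map \<open>X \<mapsto> N + f(X)\<close>; see
  \<open>tensor_power_lsmult_coset\<close> and \<open>tensor_power_rsmult_coset\<close> below.
\<close>

definition tensor_power ::
  "('h, 'b) ring_scheme \<Rightarrow> 'h set \<Rightarrow> nat \<Rightarrow> ('h, 'h, ('h list \<Rightarrow>\<^sub>0 int) set) bimodule" where
  "tensor_power H R n =
     (let F = tensor_free H n; N = tensor_null H R n in
     \<lparr>carrier = carrier (F Mod N),
      monoid.mult = undefined, one = undefined,
      ring.zero = one (F Mod N),
      ring.add = monoid.mult (F Mod N),
      lsmult = (\<lambda>a X. N <#>\<^bsub>F\<^esub> frag_extend (\<lambda>xs. frag_of (lmult_first H a xs)) ` X),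
      rsmult = (\<lambda>X b. N <#>\<^bsub>F\<^esub> frag_extend (\<lambda>xs. frag_of (rmult_last H b xs)) ` X)\<rparr>)"

definition mult_bimodule :: "('h, 'b) ring_scheme \<Rightarrow> 'h set \<Rightarrow> ('h, 'h, 'h) bimodule" where
  "mult_bimodule H M =
     \<lparr>carrier = M, monoid.mult = undefined, one = undefined, ring.zero = \<zero>\<^bsub>H\<^esub>, ring.add = ring.add H,
      lsmult = monoid.mult H, rsmult = monoid.mult H\<rparr>"


subsection \<open>The bimodule operations on cosets, and the case of one factor\<close>

lemma tensor_relators_subset:
  assumes "ring H" "R \<subseteq> carrier H"
  shows "tensor_relators H R n \<subseteq> carrier (tensor_free H n)"
proof -
  interpret ring H by fact
  show ?thesis
    unfolding tensor_relators_def tensor_free_def using assms(2)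
    by (force dest!: subsetD[OF keys_diff] simp: subset_iff)
qed

lemma tensor_null_subgroup:
  assumes "ring H" "R \<subseteq> carrier H"
  shows "subgroup (tensor_null H R n) (tensor_free H n)"
  unfolding tensor_null_def
  by (rule group.generate_is_subgroup)
     (use tensor_relators_subset[OF assms] in \<open>auto simp: tensor_free_def\<close>)

lemma tensor_null_frag_extend:
  assumes H: "ring H" "R \<subseteq> carrier H"
    and rel: "\<And>c. c \<in> tensor_relators H R n \<Longrightarrow>
      frag_extend (\<lambda>xs. frag_of (g xs)) c \<in> tensor_relators H R n"
    and c: "c \<in> tensor_null H R n"
  shows "frag_extend (\<lambda>xs. frag_of (g xs)) c \<in> tensor_null H R n"
proof -
  interpret N: subgroup "tensor_null H R n" "tensor_free H n"
    by (rule tensor_null_subgroup[OF H])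
  interpret F: group "tensor_free H n"
    by (simp add: tensor_free_def)
  have minus: "inv\<^bsub>tensor_free H n\<^esub> d = - d" if "d \<in> carrier (tensor_free H n)" for d
    using that by (simp add: tensor_free_def)
  have rels: "d \<in> tensor_null H R n" "d \<in> carrier (tensor_free H n)"
    if "d \<in> tensor_relators H R n" for d
    using that tensor_relators_subset[OF H, of n] by (auto simp: tensor_null_def intro: generate.incl)
  show ?thesis
    using c unfolding tensor_null_def
  proof (induction rule: generate.induct)
    case one
    then show ?case using generate.one[of "tensor_free H n"] by (simp add: tensor_free_def)
  next
    case (incl h)
    then show ?case by (intro generate.incl rel)
  next
    case (inv h)
    have "inv\<^bsub>tensor_free H n\<^esub> frag_extend (\<lambda>xs. frag_of (g xs)) h
        \<in> generate (tensor_free H n) (tensor_relators H R n)"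
      by (intro generate.inv rel inv)
    then show ?case using inv rels rel by (simp add: minus frag_extend_minus)
  next
    case (eng h1 h2)
    from generate.eng[OF eng.IH] show ?case
      by (simp add: tensor_free_def frag_extend_add)
  qed
qed

lemma induced_coset:
  assumes H: "ring H" "R \<subseteq> carrier H"
    and rel: "\<And>c. c \<in> tensor_relators H R n \<Longrightarrow>
      frag_extend (\<lambda>xs. frag_of (g xs)) c \<in> tensor_relators H R n"
  defines "N \<equiv> tensor_null H R n" and "F \<equiv> tensor_free H n"
  shows "N <#>\<^bsub>F\<^esub> frag_extend (\<lambda>xs. frag_of (g xs)) ` (N #>\<^bsub>F\<^esub> c) =
         N #>\<^bsub>F\<^esub> frag_extend (\<lambda>xs. frag_of (g xs)) c"
proof -
  interpret N: subgroup N F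
    unfolding N_def F_def by (rule tensor_null_subgroup[OF H])
  have null: "frag_extend (\<lambda>xs. frag_of (g xs)) d \<in> N" if "d \<in> N" for d
    using tensor_null_frag_extend[OF H rel] that unfolding N_def by blast
  have plus: "x \<otimes>\<^bsub>F\<^esub> y = x + y" for x y by (simp add: F_def tensor_free_def)
  have zero: "0 \<in> N" using N.one_closed by (simp add: F_def tensor_free_def)
  have add: "x + y \<in> N" if "x \<in> N" "y \<in> N" for x y
    using N.m_closed[OF that] by (simp add: plus)
  show ?thesis
  proof (intro equalityI subsetI)
    fix u assume "u \<in> N <#>\<^bsub>F\<^esub> frag_extend (\<lambda>xs. frag_of (g xs)) ` (N #>\<^bsub>F\<^esub> c)"
    then obtain d e where "d \<in> N" "e \<in> N" "u = d + frag_extend (\<lambda>xs. frag_of (g xs)) (e + c)"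
      by (auto simp: set_mult_def r_coset_def plus)
    then have "u = (d + frag_extend (\<lambda>xs. frag_of (g xs)) e) + frag_extend (\<lambda>xs. frag_of (g xs)) c"
      and "d + frag_extend (\<lambda>xs. frag_of (g xs)) e \<in> N"
      by (simp_all add: frag_extend_add add null)
    then show "u \<in> N #>\<^bsub>F\<^esub> frag_extend (\<lambda>xs. frag_of (g xs)) c"
      unfolding r_coset_def plus by blast
  next
    fix u assume "u \<in> N #>\<^bsub>F\<^esub> frag_extend (\<lambda>xs. frag_of (g xs)) c"
    then obtain d where "d \<in> N" "u = d + frag_extend (\<lambda>xs. frag_of (g xs)) (0 + c)"
      by (auto simp: r_coset_def plus)
    then show "u \<in> N <#>\<^bsub>F\<^esub> frag_extend (\<lambda>xs. frag_of (g xs)) ` (N #>\<^bsub>F\<^esub> c)"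
      unfolding r_coset_def set_mult_def plus using zero by blast
  qed
qed

lemma tensor_relators_lmult_first:
  assumes H: "ring H" "R \<subseteq> carrier H" and a: "a \<in> carrier H"
    and c: "c \<in> tensor_relators H R n"
  shows "frag_extend (\<lambda>xs. frag_of (lmult_first H a xs)) c \<in> tensor_relators H R n"
proof -
  interpret ring H by fact
  have move: "lmult_first H a ((u # us) @ ys) = ((a \<otimes>\<^bsub>H\<^esub> u) # us) @ ys" for u us ys
    by (simp add: lmult_first_def)
  from c consider
    (add) us vs x y where
      "c = frag_of (us @ [x \<oplus>\<^bsub>H\<^esub> y] @ vs) - frag_of (us @ [x] @ vs) - frag_of (us @ [y] @ vs)"
      "set us \<subseteq> carrier H" "set vs \<subseteq> carrier H" "x \<in> carrier H" "y \<in> carrier H"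
      "length us + 1 + length vs = n"
  | (bal) us vs x y r where
      "c = frag_of (us @ [x \<otimes>\<^bsub>H\<^esub> r, y] @ vs) - frag_of (us @ [x, r \<otimes>\<^bsub>H\<^esub> y] @ vs)"
      "set us \<subseteq> carrier H" "set vs \<subseteq> carrier H" "x \<in> carrier H" "y \<in> carrier H"
      "r \<in> R" "length us + 2 + length vs = n"
    unfolding tensor_relators_def by blast
  then show ?thesis
  proof cases
    case add
    show ?thesis
    proof (cases us)
      case Nil
      then have "frag_extend (\<lambda>xs. frag_of (lmult_first H a xs)) c =
        frag_of ([] @ [a \<otimes>\<^bsub>H\<^esub> x \<oplus>\<^bsub>H\<^esub> a \<otimes>\<^bsub>H\<^esub> y] @ vs) - frag_of ([] @ [a \<otimes>\<^bsub>H\<^esub> x] @ vs)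
        - frag_of ([] @ [a \<otimes>\<^bsub>H\<^esub> y] @ vs)"
        using add a by (simp add: frag_extend_diff lmult_first_def r_distr)
      then show ?thesis
        unfolding tensor_relators_def
        using add a Nil
        by (intro UnI1 CollectI exI[of _ "[]"] exI[of _ vs] exI[of _ "a \<otimes>\<^bsub>H\<^esub> x"] exI[of _ "a \<otimes>\<^bsub>H\<^esub> y"]) simp
    next
      case (Cons u us')
      have "frag_extend (\<lambda>xs. frag_of (lmult_first H a xs)) c =
        frag_of (((a \<otimes>\<^bsub>H\<^esub> u) # us') @ [x \<oplus>\<^bsub>H\<^esub> y] @ vs) - frag_of (((a \<otimes>\<^bsub>H\<^esub> u) # us') @ [x] @ vs)
        - frag_of (((a \<otimes>\<^bsub>H\<^esub> u) # us') @ [y] @ vs)"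
        unfolding add(1) Cons by (simp add: frag_extend_diff lmult_first_def)
      then show ?thesis
        unfolding tensor_relators_def
        using add a Cons
        by (intro UnI1 CollectI exI[of _ "(a \<otimes>\<^bsub>H\<^esub> u) # us'"] exI[of _ vs] exI[of _ x] exI[of _ y]) simp
    qed
  next
    case bal
    show ?thesis
    proof (cases us)
      case Nil
      then have "frag_extend (\<lambda>xs. frag_of (lmult_first H a xs)) c =
        frag_of ([] @ [a \<otimes>\<^bsub>H\<^esub> x \<otimes>\<^bsub>H\<^esub> r, y] @ vs) - frag_of ([] @ [a \<otimes>\<^bsub>H\<^esub> x, r \<otimes>\<^bsub>H\<^esub> y] @ vs)"
        using bal a H(2) by (simp add: frag_extend_diff lmult_first_def m_assoc subset_iff)
      then show ?thesis
        unfolding tensor_relators_def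
        using bal a Nil
        by (intro UnI2 CollectI exI[of _ "[]"] exI[of _ vs] exI[of _ "a \<otimes>\<^bsub>H\<^esub> x"] exI[of _ y] exI[of _ r]) simp
    next
      case (Cons u us')
      have "frag_extend (\<lambda>xs. frag_of (lmult_first H a xs)) c =
        frag_of (((a \<otimes>\<^bsub>H\<^esub> u) # us') @ [x \<otimes>\<^bsub>H\<^esub> r, y] @ vs)
        - frag_of (((a \<otimes>\<^bsub>H\<^esub> u) # us') @ [x, r \<otimes>\<^bsub>H\<^esub> y] @ vs)"
        unfolding bal(1) Cons by (simp add: frag_extend_diff lmult_first_def)
      then show ?thesis
        unfolding tensor_relators_def
        using bal a Cons
        by (intro UnI2 CollectI exI[of _ "(a \<otimes>\<^bsub>H\<^esub> u) # us'"] exI[of _ vs] exI[of _ x] exI[of _ y]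
            exI[of _ r]) simp
    qed
  qed
qed

lemma tensor_relators_rmult_last:
  assumes H: "ring H" "R \<subseteq> carrier H" and b: "b \<in> carrier H"
    and c: "c \<in> tensor_relators H R n"
  shows "frag_extend (\<lambda>xs. frag_of (rmult_last H b xs)) c \<in> tensor_relators H R n"
proof -
  interpret ring H by fact
  from c consider
    (add) us vs x y where
      "c = frag_of (us @ [x \<oplus>\<^bsub>H\<^esub> y] @ vs) - frag_of (us @ [x] @ vs) - frag_of (us @ [y] @ vs)"
      "set us \<subseteq> carrier H" "set vs \<subseteq> carrier H" "x \<in> carrier H" "y \<in> carrier H"
      "length us + 1 + length vs = n"
  | (bal) us vs x y r where
      "c = frag_of (us @ [x \<otimes>\<^bsub>H\<^esub> r, y] @ vs) - frag_of (us @ [x, r \<otimes>\<^bsub>H\<^esub> y] @ vs)"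
      "set us \<subseteq> carrier H" "set vs \<subseteq> carrier H" "x \<in> carrier H" "y \<in> carrier H"
      "r \<in> R" "length us + 2 + length vs = n"
    unfolding tensor_relators_def by blast
  then show ?thesis
  proof cases
    case add
    show ?thesis
    proof (cases vs rule: rev_cases)
      case Nil
      then have "frag_extend (\<lambda>xs. frag_of (rmult_last H b xs)) c =
        frag_of (us @ [x \<otimes>\<^bsub>H\<^esub> b \<oplus>\<^bsub>H\<^esub> y \<otimes>\<^bsub>H\<^esub> b] @ []) - frag_of (us @ [x \<otimes>\<^bsub>H\<^esub> b] @ [])
        - frag_of (us @ [y \<otimes>\<^bsub>H\<^esub> b] @ [])"
        using add b by (simp add: frag_extend_diff rmult_last_def l_distr)
      then show ?thesis
        unfolding tensor_relators_def
        using add b Nil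
        by (intro UnI1 CollectI exI[of _ us] exI[of _ "[]"] exI[of _ "x \<otimes>\<^bsub>H\<^esub> b"] exI[of _ "y \<otimes>\<^bsub>H\<^esub> b"]) simp
    next
      case (snoc vs' v)
      have "frag_extend (\<lambda>xs. frag_of (rmult_last H b xs)) c =
        frag_of (us @ [x \<oplus>\<^bsub>H\<^esub> y] @ (vs' @ [v \<otimes>\<^bsub>H\<^esub> b])) - frag_of (us @ [x] @ (vs' @ [v \<otimes>\<^bsub>H\<^esub> b]))
        - frag_of (us @ [y] @ (vs' @ [v \<otimes>\<^bsub>H\<^esub> b]))"
        unfolding add(1) snoc by (simp add: frag_extend_diff rmult_last_def butlast_append)
      then show ?thesis
        unfolding tensor_relators_def
        using add b snoc
        by (intro UnI1 CollectI exI[of _ us] exI[of _ "vs' @ [v \<otimes>\<^bsub>H\<^esub> b]"] exI[of _ x] exI[of _ y]) simp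
    qed
  next
    case bal
    show ?thesis
    proof (cases vs rule: rev_cases)
      case Nil
      then have "frag_extend (\<lambda>xs. frag_of (rmult_last H b xs)) c =
        frag_of (us @ [x \<otimes>\<^bsub>H\<^esub> r, y \<otimes>\<^bsub>H\<^esub> b] @ []) - frag_of (us @ [x, r \<otimes>\<^bsub>H\<^esub> (y \<otimes>\<^bsub>H\<^esub> b)] @ [])"
        using bal b H(2) by (simp add: frag_extend_diff rmult_last_def m_assoc subset_iff butlast_append)
      then show ?thesis
        unfolding tensor_relators_def
        using bal b Nil
        by (intro UnI2 CollectI exI[of _ us] exI[of _ "[]"] exI[of _ x] exI[of _ "y \<otimes>\<^bsub>H\<^esub> b"] exI[of _ r]) simp
    next
      case (snoc vs' v)
      have "frag_extend (\<lambda>xs. frag_of (rmult_last H b xs)) c =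
        frag_of (us @ [x \<otimes>\<^bsub>H\<^esub> r, y] @ (vs' @ [v \<otimes>\<^bsub>H\<^esub> b]))
        - frag_of (us @ [x, r \<otimes>\<^bsub>H\<^esub> y] @ (vs' @ [v \<otimes>\<^bsub>H\<^esub> b]))"
        unfolding bal(1) snoc by (simp add: frag_extend_diff rmult_last_def butlast_append)
      then show ?thesis
        unfolding tensor_relators_def
        using bal b snoc
        by (intro UnI2 CollectI exI[of _ us] exI[of _ "vs' @ [v \<otimes>\<^bsub>H\<^esub> b]"] exI[of _ x] exI[of _ y]
            exI[of _ r]) simp
    qed
  qed
qed

lemma tensor_power_lsmult_coset:
  assumes "ring H" "R \<subseteq> carrier H" "a \<in> carrier H"
  shows "lsmult (tensor_power H R n) a (tensor_null H R n #>\<^bsub>tensor_free H n\<^esub> c) =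
    tensor_null H R n #>\<^bsub>tensor_free H n\<^esub> frag_extend (\<lambda>xs. frag_of (lmult_first H a xs)) c"
  using induced_coset[OF assms(1,2) tensor_relators_lmult_first[OF assms]]
  by (simp add: tensor_power_def Let_def)

lemma tensor_power_rsmult_coset:
  assumes "ring H" "R \<subseteq> carrier H" "b \<in> carrier H"
  shows "rsmult (tensor_power H R n) (tensor_null H R n #>\<^bsub>tensor_free H n\<^esub> c) b =
    tensor_null H R n #>\<^bsub>tensor_free H n\<^esub> frag_extend (\<lambda>xs. frag_of (rmult_last H b xs)) c"
  using induced_coset[OF assms(1,2) tensor_relators_rmult_last[OF assms]]
  by (simp add: tensor_power_def Let_def)

lemma tensor_power_1_iso:
  assumes H: "ring H" "R \<subseteq> carrier H"
  shows "(\<lambda>x. tensor_null H R 1 #>\<^bsub>tensor_free H 1\<^esub> frag_of [x]) \<in>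
    bimodule_iso (carrier H) (carrier H) (mult_bimodule H (carrier H)) (tensor_power H R 1)"
proof -
  interpret ring H by fact
  define N where "N = tensor_null H R 1"
  define F where "F = tensor_free H 1"
  interpret F: comm_group F
    unfolding F_def tensor_free_def by (rule abelian_free_Abelian_group)
  interpret N: subgroup N F
    unfolding N_def F_def by (rule tensor_null_subgroup[OF H])
  interpret N: normal N F
    by (rule F.subgroup_imp_normal) (rule N.subgroup_axioms)
  have plus: "x \<otimes>\<^bsub>F\<^esub> y = x + y" for x y by (simp add: F_def tensor_free_def)
  have gens: "{xs. length xs = 1 \<and> set xs \<subseteq> carrier H} = (\<lambda>x. [x]) ` carrier H"
    by (auto simp: length_Suc_conv)
  have F_carrier: "carrier F = {c. Poly_Mapping.keys c \<subseteq> (\<lambda>x. [x]) ` carrier H}"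
    unfolding F_def tensor_free_def gens by (simp add: free_Abelian_group_def)
  have in_F: "frag_of [x] \<in> carrier F" if "x \<in> carrier H" for x
    using that by (simp add: F_carrier)
  have rel: "frag_of [x \<oplus>\<^bsub>H\<^esub> y] - frag_of [x] - frag_of [y] \<in> N"
    if "x \<in> carrier H" "y \<in> carrier H" for x y
    unfolding N_def tensor_null_def tensor_relators_def
    by (intro generate.incl UnI1 CollectI exI[of _ "[]"] exI[of _ x] exI[of _ y]) (use that in simp)
  have coset_eq: "N #>\<^bsub>F\<^esub> c = N #>\<^bsub>F\<^esub> d \<longleftrightarrow> c - d \<in> N" if "c \<in> carrier F" "d \<in> carrier F" for c d
  proof -
    have "inv\<^bsub>F\<^esub> d = - d" using that by (simp add: F_def tensor_free_def)
    then have "c \<in> N #>\<^bsub>F\<^esub> d \<longleftrightarrow> c - d \<in> N"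
      using N.rcos_module[OF F.is_group that(2,1)] by (simp add: plus)
    moreover have "c \<in> N #>\<^bsub>F\<^esub> c"
      by (rule F.rcos_self[OF that(1) N.subgroup_axioms])
    ultimately show ?thesis
      using F.repr_independence[OF _ that(2) N.subgroup_axioms] by metis
  qed
  have coset_add: "(N #>\<^bsub>F\<^esub> c) <#>\<^bsub>F\<^esub> (N #>\<^bsub>F\<^esub> d) = N #>\<^bsub>F\<^esub> (c + d)"
    if "c \<in> carrier F" "d \<in> carrier F" for c d
    using N.rcos_sum[OF that] by (simp add: plus)
  let ?f = "\<lambda>x. N #>\<^bsub>F\<^esub> frag_of [x]"
  have add: "?f (x \<oplus>\<^bsub>H\<^esub> y) = ?f x <#>\<^bsub>F\<^esub> ?f y" if "x \<in> carrier H" "y \<in> carrier H" for x y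
    using that rel[OF that] in_F F.m_closed[OF in_F in_F, of x y]
    by (simp add: coset_add coset_eq plus algebra_simps)
  obtain e where e: "e \<in> hom (free_Abelian_group ((\<lambda>x. [x]) ` carrier H)) (add_monoid H)"
    and e_of: "\<And>x. x \<in> (\<lambda>x. [x]) ` carrier H \<Longrightarrow> e (frag_of x) = hd x"
    by (rule comm_group.free_Abelian_group_universal[OF a_comm_group, of hd "(\<lambda>x. [x]) ` carrier H"]) auto
  have eF: "e \<in> hom F (add_monoid H)"
    using e unfolding F_def tensor_free_def gens .
  interpret e: group_hom F "add_monoid H" e
    by unfold_locales (rule eF)
  have e_diff: "e (c - d) = e c \<ominus>\<^bsub>H\<^esub> e d" if "c \<in> carrier F" "d \<in> carrier F" for c d
  proof -
    have "inv\<^bsub>F\<^esub> d = - d" using that by (simp add: F_def tensor_free_def)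
    then have "c - d = c \<otimes>\<^bsub>F\<^esub> inv\<^bsub>F\<^esub> d" by (simp add: plus)
    then show ?thesis using that e.hom_mult[OF that(1) F.inv_closed[OF that(2)]] e.hom_inv[OF that(2)]
      by (simp add: a_minus_def a_inv_def)
  qed
  have e_null: "e c = \<zero>\<^bsub>H\<^esub>" if c: "c \<in> N" for c
  proof -
    have "tensor_relators H R 1 \<subseteq> kernel F (add_monoid H) e"
    proof
      fix c assume c: "c \<in> tensor_relators H R 1"
      then have cF: "c \<in> carrier F"
        using tensor_relators_subset[OF H] unfolding F_def by blast
      from c obtain x y where xy: "x \<in> carrier H" "y \<in> carrier H"
        "c = frag_of [x \<oplus>\<^bsub>H\<^esub> y] - frag_of [x] - frag_of [y]"
        unfolding tensor_relators_def by auto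
      have "frag_of [x \<oplus>\<^bsub>H\<^esub> y] - frag_of [x] \<in> carrier F"
        using in_F xy by (auto simp: F_carrier dest!: subsetD[OF keys_diff])
      then have "e c = (x \<oplus>\<^bsub>H\<^esub> y) \<ominus>\<^bsub>H\<^esub> x \<ominus>\<^bsub>H\<^esub> y"
        using xy in_F by (simp add: e_diff e_of)
      also have "\<dots> = \<zero>\<^bsub>H\<^esub>"
        using xy by algebra
      finally show "c \<in> kernel F (add_monoid H) e"
        using cF by (simp add: kernel_def)
    qed
    then have "generate F (tensor_relators H R 1) \<subseteq> kernel F (add_monoid H) e"
      by (rule F.generate_subgroup_incl) (rule e.subgroup_kernel)
    with c show ?thesis
      unfolding N_def F_def tensor_null_def kernel_def by auto
  qed
  have "bij_betw ?f (carrier H) (carrier (F Mod N))"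
    unfolding bij_betw_def
  proof
    show "inj_on ?f (carrier H)"
    proof (rule inj_onI)
      fix x y assume xy: "x \<in> carrier H" "y \<in> carrier H" "?f x = ?f y"
      then have "e (frag_of [x] - frag_of [y]) = \<zero>\<^bsub>H\<^esub>"
        by (intro e_null) (simp add: coset_eq in_F)
      then have "x \<ominus>\<^bsub>H\<^esub> y = \<zero>\<^bsub>H\<^esub>"
        using xy by (simp add: e_diff in_F e_of)
      then show "x = y" using xy by simp
    qed
    have surj: "\<exists>x\<in>carrier H. N #>\<^bsub>F\<^esub> c = ?f x" if "c \<in> carrier F" for c
    proof -
      have "Poly_Mapping.keys c \<subseteq> (\<lambda>x. [x]) ` carrier H"
        using that by (simp add: F_carrier)
      then have "c \<in> carrier F \<and> (\<exists>x\<in>carrier H. N #>\<^bsub>F\<^esub> c = ?f x)"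
      proof (induction rule: frag_induction)
        case zero
        have "?f \<zero>\<^bsub>H\<^esub> <#>\<^bsub>F\<^esub> ?f \<zero>\<^bsub>H\<^esub> = ?f \<zero>\<^bsub>H\<^esub>"
          using add[of "\<zero>\<^bsub>H\<^esub>" "\<zero>\<^bsub>H\<^esub>"] by simp
        then have "frag_of [\<zero>\<^bsub>H\<^esub>] \<in> N"
          using F.m_closed[OF in_F in_F, of "\<zero>\<^bsub>H\<^esub>" "\<zero>\<^bsub>H\<^esub>"]
          by (simp add: coset_add in_F coset_eq plus)
        moreover have "0 \<in> carrier F" by (simp add: F_carrier)
        moreover have "- frag_of [\<zero>\<^bsub>H\<^esub>] \<in> N"
          using N.m_inv_closed[OF calculation(1)] in_F[of "\<zero>\<^bsub>H\<^esub>"] by (simp add: F_def tensor_free_def)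
        ultimately show ?case
          by (auto intro!: bexI[of _ "\<zero>\<^bsub>H\<^esub>"] simp: coset_eq in_F)
      next
        case (one x)
        then show ?case using in_F by auto
      next
        case (diff c d)
        then obtain x y where xy: "x \<in> carrier H" "y \<in> carrier H" "N #>\<^bsub>F\<^esub> c = ?f x" "N #>\<^bsub>F\<^esub> d = ?f y"
          and cd: "c \<in> carrier F" "d \<in> carrier F" by blast
        have cdF: "c - d \<in> carrier F"
          using cd by (auto simp: F_carrier dest!: subsetD[OF keys_diff])
        have "?f x = ?f (x \<ominus>\<^bsub>H\<^esub> y) <#>\<^bsub>F\<^esub> ?f y"
          using add[of "x \<ominus>\<^bsub>H\<^esub> y" y] xy by (simp add: a_minus_def a_assoc l_neg)
        then have "N #>\<^bsub>F\<^esub> c = N #>\<^bsub>F\<^esub> (frag_of [x \<ominus>\<^bsub>H\<^esub> y] + d)"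
          using xy cd in_F by (metis coset_add minus_closed)
        moreover have "frag_of [x \<ominus>\<^bsub>H\<^esub> y] + d \<in> carrier F"
          using F.m_closed[OF in_F cd(2)] xy by (simp add: plus)
        ultimately have "c - (frag_of [x \<ominus>\<^bsub>H\<^esub> y] + d) \<in> N"
          using coset_eq cd by blast
        then have "N #>\<^bsub>F\<^esub> (c - d) = ?f (x \<ominus>\<^bsub>H\<^esub> y)"
          using xy in_F cdF by (simp add: coset_eq algebra_simps)
        then show ?case using xy cdF by (blast intro: minus_closed)
      qed
      then show ?thesis by blast
    qed
    show "?f ` carrier H = carrier (F Mod N)"
    proof (intro equalityI subsetI)
      fix X assume "X \<in> ?f ` carrier H"
      then show "X \<in> carrier (F Mod N)"
        using in_F by (auto simp: FactGroup_def RCOSETS_def)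
    next
      fix X assume "X \<in> carrier (F Mod N)"
      then obtain c where "c \<in> carrier F" "X = N #>\<^bsub>F\<^esub> c"
        by (auto simp: FactGroup_def RCOSETS_def)
      then show "X \<in> ?f ` carrier H"
        using surj by auto
    qed
  qed
  moreover have "lsmult (tensor_power H R 1) a (?f x) = ?f (a \<otimes>\<^bsub>H\<^esub> x)" if "a \<in> carrier H" for a x
    using that tensor_power_lsmult_coset[OF H, of a 1 "frag_of [x]"]
    by (simp add: N_def F_def lmult_first_def)
  moreover have "rsmult (tensor_power H R 1) (?f x) b = ?f (x \<otimes>\<^bsub>H\<^esub> b)" if "b \<in> carrier H" for b x
    using that tensor_power_rsmult_coset[OF H, of b 1 "frag_of [x]"]
    by (simp add: N_def F_def rmult_last_def)
  moreover have "carrier (tensor_power H R 1) = carrier (F Mod N)"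
    "X \<oplus>\<^bsub>tensor_power H R 1\<^esub> Y = X <#>\<^bsub>F\<^esub> Y" for X Y
    by (simp_all add: tensor_power_def Let_def N_def F_def FactGroup_def)
  ultimately show ?thesis
    unfolding bimodule_iso_def mult_bimodule_def N_def[symmetric] F_def[symmetric]
    by (simp add: add)
qed


section \<open>Depth of a ring extension\<close>

text \<open>
  The case \<open>n = 0\<close> of odd depth is separate because the zeroth tensor power is \<open>R\<close>
  itself, which lives in another type than the higher tensor powers.
\<close>

definition odd_depth :: "('h, 'b) ring_scheme \<Rightarrow> 'h set \<Rightarrow> nat \<Rightarrow> bool" where
  "odd_depth H R n \<longleftrightarrow>
     (if n = 0 then similar R R (tensor_power H R 1) (mult_bimodule H R)
      else similar R R (tensor_power H R (n + 1)) (tensor_power H R n))"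

definition even_depth :: "('h, 'b) ring_scheme \<Rightarrow> 'h set \<Rightarrow> nat \<Rightarrow> bool" where
  "even_depth H R n \<longleftrightarrow>
     similar R (carrier H) (tensor_power H R (n + 1)) (tensor_power H R n) \<or>
     similar (carrier H) R (tensor_power H R (n + 1)) (tensor_power H R n)"

definition has_depth :: "('h, 'b) ring_scheme \<Rightarrow> 'h set \<Rightarrow> nat \<Rightarrow> bool" where
  "has_depth H R m \<longleftrightarrow>
     (\<exists>n. m = 2 * n + 1 \<and> odd_depth H R n) \<or> (\<exists>n\<ge>1. m = 2 * n \<and> even_depth H R n)"

definition min_depth :: "'h set \<Rightarrow> ('h, 'b) ring_scheme \<Rightarrow> enat" where
  "min_depth R H = (INF m\<in>{m. m > 0 \<and> has_depth H R m}. enat m)"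


section \<open>The Drinfel'd double of a group algebra\<close>

definition group_algebra :: "'k::field itself \<Rightarrow> ('g, 'b) monoid_scheme \<Rightarrow> ('g \<Rightarrow> 'k) ring" where
  "group_algebra k G =
     \<lparr>carrier = {c. \<forall>g. g \<notin> carrier G \<longrightarrow> c g = 0},
      monoid.mult = (\<lambda>c d w. \<Sum>g\<in>carrier G. \<Sum>h\<in>carrier G. c g * d h * of_bool (w = g \<otimes>\<^bsub>G\<^esub> h)),
      one = (\<lambda>w. of_bool (w = \<one>\<^bsub>G\<^esub>)),
      ring.zero = (\<lambda>w. 0),
      ring.add = (\<lambda>c d w. c w + d w)\<rparr>"

text \<open>
  A function \<open>a\<close> on \<open>G \<times> G\<close> encodes \<open>\<Sum> a (x, g) \<cdot> (p\<^sub>x \<bowtie> g)\<close>. The product is the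
  bilinear extension of
  \<open>(p\<^sub>x \<bowtie> g) (p\<^sub>y \<bowtie> h) = p\<^sub>x p\<^bsub>g y g\<inverse>\<^esub> \<bowtie> g h\<close>, in which
  \<open>p\<^sub>x p\<^bsub>g y g\<inverse>\<^esub>\<close> is the pointwise product of functions on \<open>G\<close>; compare
  \<open>double_basis_mult\<close> below.
\<close>

definition drinfeld_double ::
  "'k::field itself \<Rightarrow> ('g, 'b) monoid_scheme \<Rightarrow> ('g \<times> 'g \<Rightarrow> 'k) ring" where
  "drinfeld_double k G =
     \<lparr>carrier = {a. \<forall>x g. x \<notin> carrier G \<or> g \<notin> carrier G \<longrightarrow> a (x, g) = 0},
      monoid.mult = (\<lambda>a b (z, w). \<Sum>x\<in>carrier G. \<Sum>g\<in>carrier G. \<Sum>y\<in>carrier G. \<Sum>h\<in>carrier G.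
        a (x, g) * b (y, h) *
        (of_bool (z = x) * of_bool (z = g \<otimes>\<^bsub>G\<^esub> y \<otimes>\<^bsub>G\<^esub> inv\<^bsub>G\<^esub> g) * of_bool (w = g \<otimes>\<^bsub>G\<^esub> h))),
      one = (\<lambda>(z, w). of_bool (z \<in> carrier G \<and> w = \<one>\<^bsub>G\<^esub>)),
      ring.zero = (\<lambda>(z, w). 0),
      ring.add = (\<lambda>a b (z, w). a (z, w) + b (z, w))\<rparr>"

text \<open>The map \<open>g \<mapsto> \<epsilon> \<bowtie> g\<close>, extended linearly, where \<open>\<epsilon> = \<Sum> p\<^sub>y\<close>.\<close>

definition group_algebra_embed ::
  "('g, 'b) monoid_scheme \<Rightarrow> ('g \<Rightarrow> 'k::field) \<Rightarrow> ('g \<times> 'g \<Rightarrow> 'k)" where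
  "group_algebra_embed G c = (\<lambda>(y, g). of_bool (y \<in> carrier G) * c g)"

definition group_algebra_in_double ::
  "'k::field itself \<Rightarrow> ('g, 'b) monoid_scheme \<Rightarrow> ('g \<times> 'g \<Rightarrow> 'k) set" where
  "group_algebra_in_double k G = group_algebra_embed G ` carrier (group_algebra k G)"


subsection \<open>The double is a ring that contains the group algebra\<close>

context group
begin

lemma double_mult_coord:
  assumes fin: "finite (carrier G)" and z: "z \<in> carrier G" and w: "w \<in> carrier G"
  shows "(a \<otimes>\<^bsub>drinfeld_double (k :: 'k::field itself) G\<^esub> b) (z, w) =
    (\<Sum>g\<in>carrier G. a (z, g) * b (inv g \<otimes> z \<otimes> g, inv g \<otimes> w))"
proof -
  have *: "(\<Sum>y\<in>carrier G. \<Sum>h\<in>carrier G. a (x, g) * b (y, h) *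
      (of_bool (z = x) * of_bool (z = g \<otimes> y \<otimes> inv g) * of_bool (w = g \<otimes> h)))
    = (if x = z then a (z, g) * b (inv g \<otimes> z \<otimes> g, inv g \<otimes> w) else 0)"
    if x: "x \<in> carrier G" and g: "g \<in> carrier G" for x g
  proof -
    have y: "z = g \<otimes> y \<otimes> inv g \<longleftrightarrow> y = inv g \<otimes> z \<otimes> g" if "y \<in> carrier G" for y
      using that g z by (metis inv_closed m_assoc m_closed inv_solve_left inv_solve_right')
    have h: "w = g \<otimes> h \<longleftrightarrow> h = inv g \<otimes> w" if "h \<in> carrier G" for h
      using that g w by (metis inv_solve_left)
    have "(\<Sum>y\<in>carrier G. \<Sum>h\<in>carrier G. a (x, g) * b (y, h) *
      (of_bool (z = x) * of_bool (z = g \<otimes> y \<otimes> inv g) * of_bool (w = g \<otimes> h)))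
     = (\<Sum>y\<in>carrier G. \<Sum>h\<in>carrier G. if h = inv g \<otimes> w then
          (if y = inv g \<otimes> z \<otimes> g then (if x = z then a (x, g) * b (y, h) else 0) else 0) else 0)"
      by (intro sum.cong refl) (auto simp: y h)
    also have "\<dots> = (if x = z then a (z, g) * b (inv g \<otimes> z \<otimes> g, inv g \<otimes> w) else 0)"
      using fin g z w by (simp add: sum.delta)
    finally show ?thesis .
  qed
  have "(a \<otimes>\<^bsub>drinfeld_double k G\<^esub> b) (z, w) = (\<Sum>x\<in>carrier G. \<Sum>g\<in>carrier G.
     (if x = z then a (z, g) * b (inv g \<otimes> z \<otimes> g, inv g \<otimes> w) else 0))"
    by (simp add: drinfeld_double_def * cong: sum.cong)
  also have "\<dots> = (\<Sum>g\<in>carrier G. \<Sum>x\<in>carrier G.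
     (if x = z then a (z, g) * b (inv g \<otimes> z \<otimes> g, inv g \<otimes> w) else 0))"
    by (rule sum.swap)
  also have "\<dots> = (\<Sum>g\<in>carrier G. a (z, g) * b (inv g \<otimes> z \<otimes> g, inv g \<otimes> w))"
    using fin z by (simp add: sum.delta)
  finally show ?thesis .
qed

lemma double_mult_closed:
  "a \<otimes>\<^bsub>drinfeld_double (k :: 'k::field itself) G\<^esub> b \<in> carrier (drinfeld_double k G)"
  by (auto simp: drinfeld_double_def intro!: sum.neutral)

lemma double_eqI:
  assumes "a \<in> carrier (drinfeld_double (k :: 'k::field itself) G)" "b \<in> carrier (drinfeld_double k G)"
    and "\<And>z w. z \<in> carrier G \<Longrightarrow> w \<in> carrier G \<Longrightarrow> a (z, w) = b (z, w)"
  shows "a = b"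
proof (rule ext, clarify)
  fix z w show "a (z, w) = b (z, w)"
    using assms by (cases "z \<in> carrier G \<and> w \<in> carrier G") (auto simp: drinfeld_double_def)
qed

lemma double_ring:
  assumes fin: "finite (carrier G)"
  shows "ring (drinfeld_double (k :: 'k::field itself) G)" (is "ring ?D")
proof (rule ringI)
  show "abelian_group ?D"
  proof (rule abelian_groupI)
    fix x assume x: "x \<in> carrier ?D"
    show "\<exists>y\<in>carrier ?D. y \<oplus>\<^bsub>?D\<^esub> x = \<zero>\<^bsub>?D\<^esub>"
      using x by (intro bexI[of _ "\<lambda>u. - x u"]) (auto simp: drinfeld_double_def fun_eq_iff)
  qed (auto simp: drinfeld_double_def fun_eq_iff)
  note coord = double_mult_coord[OF fin]
  have one: "\<one>\<^bsub>?D\<^esub> \<in> carrier ?D"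
    by (auto simp: drinfeld_double_def)
  have one_coord: "\<one>\<^bsub>?D\<^esub> (z, w) = of_bool (w = \<one>)" if "z \<in> carrier G" for z w
    using that by (simp add: drinfeld_double_def)
  show "monoid ?D"
  proof (rule monoidI)
    fix a b c assume a: "a \<in> carrier ?D" "b \<in> carrier ?D" "c \<in> carrier ?D"
    show "a \<otimes>\<^bsub>?D\<^esub> b \<otimes>\<^bsub>?D\<^esub> c = a \<otimes>\<^bsub>?D\<^esub> (b \<otimes>\<^bsub>?D\<^esub> c)"
    proof (rule double_eqI[OF double_mult_closed double_mult_closed])
      fix z w assume zw: "z \<in> carrier G" "w \<in> carrier G"
      have "(a \<otimes>\<^bsub>?D\<^esub> b \<otimes>\<^bsub>?D\<^esub> c) (z, w) = (\<Sum>g\<in>carrier G. \<Sum>h\<in>carrier G.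
          a (z, h) * b (inv h \<otimes> z \<otimes> h, inv h \<otimes> g) * c (inv g \<otimes> z \<otimes> g, inv g \<otimes> w))"
        using zw by (simp add: coord sum_distrib_right cong: sum.cong)
      also have "\<dots> = (\<Sum>h\<in>carrier G. \<Sum>g\<in>carrier G.
          a (z, h) * b (inv h \<otimes> z \<otimes> h, inv h \<otimes> g) * c (inv g \<otimes> z \<otimes> g, inv g \<otimes> w))"
        by (rule sum.swap)
      also have "\<dots> = (\<Sum>h\<in>carrier G. \<Sum>g\<in>carrier G. a (z, h) *
          (b (inv h \<otimes> z \<otimes> h, g) * c (inv g \<otimes> (inv h \<otimes> z \<otimes> h) \<otimes> g, inv g \<otimes> (inv h \<otimes> w))))"
      proof (rule sum.cong[OF refl])
        fix h assume h: "h \<in> carrier G"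
        show "(\<Sum>g\<in>carrier G.
          a (z, h) * b (inv h \<otimes> z \<otimes> h, inv h \<otimes> g) * c (inv g \<otimes> z \<otimes> g, inv g \<otimes> w)) =
          (\<Sum>g\<in>carrier G. a (z, h) *
          (b (inv h \<otimes> z \<otimes> h, g) * c (inv g \<otimes> (inv h \<otimes> z \<otimes> h) \<otimes> g, inv g \<otimes> (inv h \<otimes> w))))"
        proof (rule sum.reindex_bij_witness[of _ "\<lambda>g. h \<otimes> g" "\<lambda>g. inv h \<otimes> g"])
          fix g assume g: "g \<in> carrier G"
          show "h \<otimes> (inv h \<otimes> g) = g" "inv h \<otimes> (h \<otimes> g) = g"
            using g h by (simp_all add: m_assoc[symmetric])
          show "inv h \<otimes> g \<in> carrier G" "h \<otimes> g \<in> carrier G"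
            using g h by simp_all
          have cancel: "h \<otimes> (inv h \<otimes> u) = u" if "u \<in> carrier G" for u
            using that h by (simp add: m_assoc[symmetric])
          have 1: "inv (inv h \<otimes> g) = inv g \<otimes> h"
            using g h by (simp add: inv_mult_group)
          have 2: "inv g \<otimes> h \<otimes> (inv h \<otimes> w) = inv g \<otimes> w"
            using g h zw by (simp add: m_assoc cancel)
          have 3: "inv g \<otimes> h \<otimes> (inv h \<otimes> z \<otimes> h) \<otimes> (inv h \<otimes> g) = inv g \<otimes> z \<otimes> g"
            using g h zw by (simp add: m_assoc cancel)
          show "a (z, h) * (b (inv h \<otimes> z \<otimes> h, inv h \<otimes> g) *
              c (inv (inv h \<otimes> g) \<otimes> (inv h \<otimes> z \<otimes> h) \<otimes> (inv h \<otimes> g),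
                 inv (inv h \<otimes> g) \<otimes> (inv h \<otimes> w))) =
            a (z, h) * b (inv h \<otimes> z \<otimes> h, inv h \<otimes> g) * c (inv g \<otimes> z \<otimes> g, inv g \<otimes> w)"
            unfolding 1 2 3 by (simp add: mult.assoc)
        qed
      qed
      also have "\<dots> = (a \<otimes>\<^bsub>?D\<^esub> (b \<otimes>\<^bsub>?D\<^esub> c)) (z, w)"
        using zw by (simp add: coord sum_distrib_left cong: sum.cong)
      finally show "(a \<otimes>\<^bsub>?D\<^esub> b \<otimes>\<^bsub>?D\<^esub> c) (z, w) = (a \<otimes>\<^bsub>?D\<^esub> (b \<otimes>\<^bsub>?D\<^esub> c)) (z, w)" .
    qed
  next
    fix a assume a: "a \<in> carrier ?D"
    show "\<one>\<^bsub>?D\<^esub> \<otimes>\<^bsub>?D\<^esub> a = a"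
    proof (rule double_eqI[OF double_mult_closed a])
      fix z w assume zw: "z \<in> carrier G" "w \<in> carrier G"
      have "(\<one>\<^bsub>?D\<^esub> \<otimes>\<^bsub>?D\<^esub> a) (z, w) =
          (\<Sum>g\<in>carrier G. if g = \<one> then a (inv g \<otimes> z \<otimes> g, inv g \<otimes> w) else 0)"
        using zw by (auto simp: coord one_coord intro!: sum.cong)
      then show "(\<one>\<^bsub>?D\<^esub> \<otimes>\<^bsub>?D\<^esub> a) (z, w) = a (z, w)"
        using zw fin by (simp add: sum.delta)
    qed
    show "a \<otimes>\<^bsub>?D\<^esub> \<one>\<^bsub>?D\<^esub> = a"
    proof (rule double_eqI[OF double_mult_closed a])
      fix z w assume zw: "z \<in> carrier G" "w \<in> carrier G"
      have eq: "inv g \<otimes> w = \<one> \<longleftrightarrow> g = w" if "g \<in> carrier G" for g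
        using that zw by (metis inv_closed inv_equality inv_inv l_inv)
      have "(a \<otimes>\<^bsub>?D\<^esub> \<one>\<^bsub>?D\<^esub>) (z, w) = (\<Sum>g\<in>carrier G. if g = w then a (z, g) else 0)"
        using zw by (auto simp: coord one_coord eq intro!: sum.cong)
      then show "(a \<otimes>\<^bsub>?D\<^esub> \<one>\<^bsub>?D\<^esub>) (z, w) = a (z, w)"
        using zw fin by (simp add: sum.delta)
    qed
  qed (use one double_mult_closed in auto)
  have add_coord: "(a \<oplus>\<^bsub>?D\<^esub> b) u = a u + b u" for a b u
    by (cases u) (simp add: drinfeld_double_def)
  have add_closed: "a \<oplus>\<^bsub>?D\<^esub> b \<in> carrier ?D" if "a \<in> carrier ?D" "b \<in> carrier ?D" for a b
    using that by (auto simp: drinfeld_double_def)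
  fix x y z assume xyz: "x \<in> carrier ?D" "y \<in> carrier ?D" "z \<in> carrier ?D"
  show "(x \<oplus>\<^bsub>?D\<^esub> y) \<otimes>\<^bsub>?D\<^esub> z = x \<otimes>\<^bsub>?D\<^esub> z \<oplus>\<^bsub>?D\<^esub> y \<otimes>\<^bsub>?D\<^esub> z"
    by (rule double_eqI[of _ k])
       (auto simp: double_mult_closed add_closed coord add_coord distrib_right sum.distrib)
  show "z \<otimes>\<^bsub>?D\<^esub> (x \<oplus>\<^bsub>?D\<^esub> y) = z \<otimes>\<^bsub>?D\<^esub> x \<oplus>\<^bsub>?D\<^esub> z \<otimes>\<^bsub>?D\<^esub> y"
    by (rule double_eqI[of _ k])
       (auto simp: double_mult_closed add_closed coord add_coord distrib_left sum.distrib)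
qed

lemma double_basis_mult:
  fixes k :: "'k::field itself"
  assumes fin: "finite (carrier G)"
    and G: "x \<in> carrier G" "g \<in> carrier G" "y \<in> carrier G" "h \<in> carrier G"
  defines "p \<equiv> (\<lambda>x g u. of_bool (u = (x, g)) :: 'k)"
  shows "p x g \<otimes>\<^bsub>drinfeld_double k G\<^esub> p y h =
    (if x = g \<otimes> y \<otimes> inv g then p x (g \<otimes> h) else (\<lambda>u. 0))"
proof (rule double_eqI[OF double_mult_closed])
  show "(if x = g \<otimes> y \<otimes> inv g then p x (g \<otimes> h) else (\<lambda>u. 0)) \<in> carrier (drinfeld_double k G)"
    using G by (auto simp: p_def drinfeld_double_def)
  fix z w assume zw: "z \<in> carrier G" "w \<in> carrier G"
  have y: "z = g \<otimes> y \<otimes> inv g \<longleftrightarrow> inv g \<otimes> z \<otimes> g = y"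
    using G zw by (metis inv_closed m_assoc m_closed inv_solve_left inv_solve_right')
  have h: "w = g \<otimes> h \<longleftrightarrow> inv g \<otimes> w = h"
    using G zw by (metis inv_solve_left)
  have "(p x g \<otimes>\<^bsub>drinfeld_double k G\<^esub> p y h) (z, w) = (\<Sum>g'\<in>carrier G. if g' = g then
      p x g (z, g) * p y h (inv g \<otimes> z \<otimes> g, inv g \<otimes> w) else 0)"
    unfolding double_mult_coord[OF fin zw] by (rule sum.cong) (auto simp: p_def)
  also have "\<dots> = p x g (z, g) * p y h (inv g \<otimes> z \<otimes> g, inv g \<otimes> w)"
    using fin G by simp
  also have "\<dots> = (if x = g \<otimes> y \<otimes> inv g then p x (g \<otimes> h) else (\<lambda>u. 0)) (z, w)"
    using y h by (auto simp: p_def)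
  finally show "(p x g \<otimes>\<^bsub>drinfeld_double k G\<^esub> p y h) (z, w) =
    (if x = g \<otimes> y \<otimes> inv g then p x (g \<otimes> h) else (\<lambda>u. 0)) (z, w)" .
qed

lemma group_algebra_embed_hom:
  assumes fin: "finite (carrier G)"
  shows "group_algebra_embed G \<in> ring_hom (group_algebra (k :: 'k::field itself) G) (drinfeld_double k G)"
proof (rule ring_hom_memI)
  fix c d assume cd: "c \<in> carrier (group_algebra k G)" "d \<in> carrier (group_algebra k G)"
  show emb: "group_algebra_embed G c \<in> carrier (drinfeld_double k G)" if "c \<in> carrier (group_algebra k G)" for c
    using that by (auto simp: group_algebra_embed_def drinfeld_double_def group_algebra_def)
  have "c \<otimes>\<^bsub>group_algebra k G\<^esub> d \<in> carrier (group_algebra k G)"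
    by (auto simp: group_algebra_def intro!: sum.neutral)
  note closed = emb[OF this]
  show "group_algebra_embed G (c \<otimes>\<^bsub>group_algebra k G\<^esub> d) =
    group_algebra_embed G c \<otimes>\<^bsub>drinfeld_double k G\<^esub> group_algebra_embed G d"
  proof (rule double_eqI[OF closed double_mult_closed])
    fix z w assume zw: "z \<in> carrier G" "w \<in> carrier G"
    have h: "w = g \<otimes> h \<longleftrightarrow> h = inv g \<otimes> w" if "g \<in> carrier G" "h \<in> carrier G" for g h
      using that zw by (metis inv_solve_left)
    have "group_algebra_embed G (c \<otimes>\<^bsub>group_algebra k G\<^esub> d) (z, w) =
      (\<Sum>g\<in>carrier G. \<Sum>h\<in>carrier G. if h = inv g \<otimes> w then c g * d h else 0)"
      using zw by (auto simp: group_algebra_embed_def group_algebra_def h intro!: sum.cong)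
    also have "\<dots> = (\<Sum>g\<in>carrier G. c g * d (inv g \<otimes> w))"
      using zw fin by (simp add: sum.delta cong: sum.cong)
    also have "\<dots> = (group_algebra_embed G c \<otimes>\<^bsub>drinfeld_double k G\<^esub> group_algebra_embed G d) (z, w)"
      using zw by (simp add: double_mult_coord[OF fin] group_algebra_embed_def cong: sum.cong)
    finally show "group_algebra_embed G (c \<otimes>\<^bsub>group_algebra k G\<^esub> d) (z, w) =
      (group_algebra_embed G c \<otimes>\<^bsub>drinfeld_double k G\<^esub> group_algebra_embed G d) (z, w)" .
  qed
qed (auto simp: group_algebra_embed_def drinfeld_double_def group_algebra_def fun_eq_iff distrib_left)

lemma group_algebra_embed_inj: "inj_on (group_algebra_embed G) (carrier (group_algebra k G))"
proof (rule inj_onI)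
  fix c d assume *: "group_algebra_embed G c = group_algebra_embed G d"
  show "c = d"
  proof
    fix g show "c g = d g"
      using fun_cong[OF *, of "(\<one>, g)"] by (simp add: group_algebra_embed_def)
  qed
qed

lemma group_algebra_in_double_subring:
  assumes fin: "finite (carrier G)"
  shows "subring (group_algebra_in_double (k :: 'k::field itself) G) (drinfeld_double k G)" (is "subring ?S ?D")
proof -
  interpret D: ring ?D by (rule double_ring[OF fin])
  note hom = group_algebra_embed_hom[OF fin, of k]
  let ?A = "group_algebra k G"
  have neg: "\<ominus>\<^bsub>?D\<^esub> group_algebra_embed G c = group_algebra_embed G (\<lambda>g. - c g)" 
    if "c \<in> carrier ?A" for c
    using ring_hom_closed[OF hom] that
    by (intro D.minus_equality) (auto simp: group_algebra_def drinfeld_double_def group_algebra_embed_def fun_eq_iff)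
  have "(\<lambda>g. - c g) \<in> carrier ?A" if "c \<in> carrier ?A" for c
    using that by (simp add: group_algebra_def)
  moreover have "c \<otimes>\<^bsub>?A\<^esub> d \<in> carrier ?A" "c \<oplus>\<^bsub>?A\<^esub> d \<in> carrier ?A" "\<one>\<^bsub>?A\<^esub> \<in> carrier ?A"
    if "c \<in> carrier ?A" "d \<in> carrier ?A" for c d
    using that by (auto simp: group_algebra_def intro!: sum.neutral)
  moreover have "\<one>\<^bsub>?A\<^esub> \<in> carrier ?A"
    by (auto simp: group_algebra_def)
  ultimately show ?thesis
    unfolding group_algebra_in_double_def
    apply (intro D.subringI)
    subgoal using ring_hom_closed[OF hom] by auto
    subgoal using ring_hom_one[OF hom] by (metis imageI)
    subgoal using neg by auto
    subgoal by (auto simp: ring_hom_mult[OF hom, symmetric])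
    subgoal by (auto simp: ring_hom_add[OF hom, symmetric])
    done
qed

end

end

theory Submission
  imports Defs
begin

text \<open>
  Write \<open>D\<close> for the double and \<open>R\<close> for \<open>kG\<close>, with counit \<open>\<epsilon>\<close>. If \<open>G\<close> is abelian, then
  \<open>D\<close> is the direct sum of the ideals \<open>p\<^sub>z D\<close>, each of which is isomorphic to \<open>R\<close> as an
  \<open>R\<close>-\<open>R\<close>-bimodule, so the depth is 1.

  Conversely, let \<open>q\<close> be an additive functional on \<open>D\<close> with \<open>q(h r) = q(h) \<epsilon>(r)\<close>. Then
  \<open>h \<otimes> h' \<mapsto> q(h) \<epsilon>(h')\<close> is defined on \<open>D \<otimes>\<^sub>R D\<close>. If \<open>D \<otimes>\<^sub>R D\<close> is a summand of \<open>D\<^sup>p\<close> as an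
  \<open>R\<close>-\<open>D\<close>-bimodule, then its elements are sums of terms \<open>m h\<close>, with \<open>m\<close> the image of 1 under
  a bimodule homomorphism from \<open>D\<close>, and \<open>r (m h) = m (r h)\<close> yields \<open>q(r h) = \<epsilon>(r) q(h)\<close>. In other
  words, \<open>R\<close> acts trivially on \<open>D / D R\<^sup>+\<close>. Since \<open>g p\<^sub>y = p\<^bsub>g y g\<inverse>\<^esub> g\<close>, this action permutes
  the basis \<open>p\<^sub>y\<close> by conjugation, and \<open>G\<close> is abelian. The other cases are similar.
\<close>

section \<open>Retracts of powers of a bimodule\<close>

text \<open>Every scalar acts by an additive endomorphism, as in a group with operators. In this
  form the axioms pass to smaller sets of scalars and to powers.\<close>

locale bimodule_on = abelian_group M
  for A :: "'r set" and B :: "'s set" and M :: "('r, 's, 'm) bimodule" (structure) +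
  assumes lsmult_closed: "a \<in> A \<Longrightarrow> x \<in> carrier M \<Longrightarrow> lsmult M a x \<in> carrier M"
    and rsmult_closed: "b \<in> B \<Longrightarrow> x \<in> carrier M \<Longrightarrow> rsmult M x b \<in> carrier M"
    and lsmult_add: "a \<in> A \<Longrightarrow> x \<in> carrier M \<Longrightarrow> y \<in> carrier M \<Longrightarrow>
      lsmult M a (x \<oplus> y) = lsmult M a x \<oplus> lsmult M a y"
    and rsmult_add: "b \<in> B \<Longrightarrow> x \<in> carrier M \<Longrightarrow> y \<in> carrier M \<Longrightarrow>
      rsmult M (x \<oplus> y) b = rsmult M x b \<oplus> rsmult M y b"
begin

lemma lsmult_zero: "a \<in> A \<Longrightarrow> lsmult M a \<zero> = \<zero>"
  by (metis l_zero add.r_cancel_one lsmult_add lsmult_closed zero_closed)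

lemma rsmult_zero: "b \<in> B \<Longrightarrow> rsmult M \<zero> b = \<zero>"
  by (metis l_zero add.r_cancel_one rsmult_add rsmult_closed zero_closed)

end

lemma bimodule_on_mono:
  "bimodule_on A B M \<Longrightarrow> A' \<subseteq> A \<Longrightarrow> B' \<subseteq> B \<Longrightarrow> bimodule_on A' B' M"
  unfolding bimodule_on_def bimodule_on_axioms_def by blast

definition bimodule_hom ::
  "'r set \<Rightarrow> 's set \<Rightarrow> ('r, 's, 'm) bimodule \<Rightarrow> ('r, 's, 'n) bimodule \<Rightarrow> ('m \<Rightarrow> 'n) set" where
  "bimodule_hom A B M N = {f. f \<in> carrier M \<rightarrow> carrier N \<and>
     (\<forall>x\<in>carrier M. \<forall>y\<in>carrier M. f (x \<oplus>\<^bsub>M\<^esub> y) = f x \<oplus>\<^bsub>N\<^esub> f y) \<and>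
     (\<forall>a\<in>A. \<forall>x\<in>carrier M. f (lsmult M a x) = lsmult N a (f x)) \<and>
     (\<forall>b\<in>B. \<forall>x\<in>carrier M. f (rsmult M x b) = rsmult N (f x) b)}"

lemma bimodule_homD:
  assumes "f \<in> bimodule_hom A B M N"
  shows "x \<in> carrier M \<Longrightarrow> f x \<in> carrier N"
    and "x \<in> carrier M \<Longrightarrow> y \<in> carrier M \<Longrightarrow> f (x \<oplus>\<^bsub>M\<^esub> y) = f x \<oplus>\<^bsub>N\<^esub> f y"
    and "a \<in> A \<Longrightarrow> x \<in> carrier M \<Longrightarrow> f (lsmult M a x) = lsmult N a (f x)"
    and "b \<in> B \<Longrightarrow> x \<in> carrier M \<Longrightarrow> f (rsmult M x b) = rsmult N (f x) b"
  using assms by (auto simp: bimodule_hom_def)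

lemma bimodule_hom_comp:
  "f \<in> bimodule_hom A B M N \<Longrightarrow> g \<in> bimodule_hom A B N L \<Longrightarrow> g \<circ> f \<in> bimodule_hom A B M L"
  by (auto simp: bimodule_hom_def Pi_iff)

text \<open>Lends the group-theoretic facts on zero, inverses, images and kernels to bimodule
  homomorphisms.\<close>

lemma bimodule_hom_group_hom:
  assumes "bimodule_on A B M" "bimodule_on A B N" "f \<in> bimodule_hom A B M N"
  shows "group_hom (add_monoid M) (add_monoid N) f"
proof -
  interpret M: bimodule_on A B M by fact
  interpret N: bimodule_on A B N by fact
  show ?thesis
    by (rule group_hom.intro[OF M.a_group N.a_group])
       (use bimodule_homD[OF assms(3)] in \<open>auto simp: group_hom_axioms_def hom_def\<close>)
qed

lemma bimodule_iso_imp_hom: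
  "f \<in> bimodule_iso A B M N \<Longrightarrow> f \<in> bimodule_hom A B M N"
  by (auto simp: bimodule_iso_def bimodule_hom_def bij_betw_def)

lemma bimodule_iso_inv_hom:
  assumes "bimodule_on A B M" and f: "f \<in> bimodule_iso A B M N"
  shows "inv_into (carrier M) f \<in> bimodule_hom A B N M"
proof -
  interpret bimodule_on A B M by fact
  let ?g = "inv_into (carrier M) f"
  have bij: "bij_betw f (carrier M) (carrier N)"
    using f by (simp add: bimodule_iso_def)
  note f_hom = bimodule_homD[OF bimodule_iso_imp_hom[OF f]]
  have g: "?g x \<in> carrier M" "f (?g x) = x" if "x \<in> carrier N" for x
    using that bij by (auto simp: bij_betw_def inv_into_into f_inv_into_f)
  have eqI: "?g x = m" if "m \<in> carrier M" "f m = x" for x m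
    using that bij by (metis bij_betw_inv_into_left)
  show ?thesis
    unfolding bimodule_hom_def
    by (auto intro!: eqI simp: g f_hom lsmult_closed rsmult_closed)
qed

lemma bimodule_power_bimodule:
  assumes "bimodule_on A B N"
  shows "bimodule_on A B (bimodule_power N p)"
proof -
  interpret bimodule_on A B N by fact
  show ?thesis
  proof (rule bimodule_on.intro)
    show "abelian_group (bimodule_power N p)"
    proof (rule abelian_groupI)
      fix x assume x: "x \<in> carrier (bimodule_power N p)"
      show "\<exists>y\<in>carrier (bimodule_power N p). y \<oplus>\<^bsub>bimodule_power N p\<^esub> x = \<zero>\<^bsub>bimodule_power N p\<^esub>"
        using x by (intro bexI[of _ "\<lambda>i\<in>{..<p}. \<ominus>\<^bsub>N\<^esub> x i"])
          (auto simp: bimodule_power_def PiE_iff l_neg intro!: restrict_ext)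
      show "\<zero>\<^bsub>bimodule_power N p\<^esub> \<oplus>\<^bsub>bimodule_power N p\<^esub> x = x"
        using x by (auto simp: bimodule_power_def PiE_iff fun_eq_iff extensional_def)
    qed (auto simp: bimodule_power_def PiE_iff a_assoc intro!: restrict_ext a_comm)
    show "bimodule_on_axioms A B (bimodule_power N p)"
      by unfold_locales
         (auto simp: bimodule_power_def PiE_iff lsmult_closed rsmult_closed lsmult_add rsmult_add
           intro!: restrict_ext)
  qed
qed

section \<open>Direct summands as retracts\<close>

text \<open>The kernel of \<open>g\<close> is a complement of the image of \<open>f\<close>: every
  \<open>x\<close> is the sum of \<open>f (g x)\<close> and an element that \<open>g\<close> kills,
  and \<open>g\<close> is injective on the image of \<open>f\<close>.\<close>

lemma retract_imp_direct_summand: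
  assumes M: "bimodule_on A B M" and P: "bimodule_on A B P"
    and f: "f \<in> bimodule_hom A B M P" and g: "g \<in> bimodule_hom A B P M"
    and gf: "\<And>m. m \<in> carrier M \<Longrightarrow> g (f m) = m"
  shows "direct_summand A B (f ` carrier M) P"
    and "f \<in> bimodule_iso A B M (P\<lparr>carrier := f ` carrier M\<rparr>)"
proof -
  interpret M: bimodule_on A B M by fact
  interpret P: bimodule_on A B P by fact
  interpret f: group_hom "add_monoid M" "add_monoid P" f by (rule bimodule_hom_group_hom[OF M P f])
  interpret g: group_hom "add_monoid P" "add_monoid M" g by (rule bimodule_hom_group_hom[OF P M g])
  note f_hom = bimodule_homD[OF f] and g_hom = bimodule_homD[OF g]
  let ?U = "f ` carrier M" and ?V = "{x \<in> carrier P. g x = \<zero>\<^bsub>M\<^esub>}"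
  have "subbimodule A B ?U P"
    unfolding subbimodule_def using f.img_is_subgroup
    by (auto simp flip: f_hom(3,4) intro!: M.lsmult_closed M.rsmult_closed)
  moreover have "subbimodule A B ?V P"
    unfolding subbimodule_def using g.subgroup_kernel
    by (auto simp: g_hom P.lsmult_closed P.rsmult_closed M.lsmult_zero M.rsmult_zero kernel_def)
  moreover have "?U \<inter> ?V = {\<zero>\<^bsub>P\<^esub>}"
    using f.hom_one g.hom_one by (auto simp: gf intro!: image_eqI[of _ _ "\<zero>\<^bsub>M\<^esub>"])
  moreover have "carrier P = {u \<oplus>\<^bsub>P\<^esub> v |u v. u \<in> ?U \<and> v \<in> ?V}"
  proof (intro equalityI subsetI)
    fix x assume x: "x \<in> carrier P"
    have gx: "g x \<in> carrier M" and fgx: "f (g x) \<in> carrier P" using x g_hom f_hom by auto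
    have "g (x \<ominus>\<^bsub>P\<^esub> f (g x)) = g x \<oplus>\<^bsub>M\<^esub> g (\<ominus>\<^bsub>P\<^esub> f (g x))"
      using x fgx by (simp add: P.minus_eq g_hom)
    also have "g (\<ominus>\<^bsub>P\<^esub> f (g x)) = \<ominus>\<^bsub>M\<^esub> g (f (g x))"
      using g.hom_inv[of "f (g x)"] fgx by (simp add: a_inv_def)
    finally have "g (x \<ominus>\<^bsub>P\<^esub> f (g x)) = \<zero>\<^bsub>M\<^esub>"
      using gx by (simp add: gf M.r_neg)
    moreover have "x = f (g x) \<oplus>\<^bsub>P\<^esub> (x \<ominus>\<^bsub>P\<^esub> f (g x))"
      using x fgx by (metis P.a_comm P.minus_closed P.minus_eq P.a_inv_closed P.a_assoc P.l_neg P.r_zero)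
    ultimately show "x \<in> {u \<oplus>\<^bsub>P\<^esub> v |u v. u \<in> ?U \<and> v \<in> ?V}"
      using x gx fgx by blast
  qed (auto intro!: f_hom)
  ultimately show "direct_summand A B ?U P"
    unfolding direct_summand_def by blast
  have "inj_on f (carrier M)"
    by (metis inj_onI gf)
  then show "f \<in> bimodule_iso A B M (P\<lparr>carrier := ?U\<rparr>)"
    by (auto simp: bimodule_iso_def bij_betw_def f_hom)
qed

text \<open>The retraction is the projection onto \<open>U\<close> along a complement
  \<open>V\<close>, followed by the inverse of \<open>f\<close>. It respects the scalars because
  both \<open>U\<close> and \<open>V\<close> are stable under them.\<close>

lemma direct_summand_imp_retract:
  assumes M: "bimodule_on A B M" and P: "bimodule_on A B P"
    and U: "direct_summand A B U P" and f: "f \<in> bimodule_iso A B M (P\<lparr>carrier := U\<rparr>)"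
  obtains g where "g \<in> bimodule_hom A B P M" "\<And>m. m \<in> carrier M \<Longrightarrow> g (f m) = m"
proof -
  interpret M: bimodule_on A B M by fact
  interpret P: bimodule_on A B P by fact
  obtain V where U: "subbimodule A B U P" and V: "subbimodule A B V P"
    and UV: "U \<inter> V = {\<zero>\<^bsub>P\<^esub>}" "carrier P = {u \<oplus>\<^bsub>P\<^esub> v |u v. u \<in> U \<and> v \<in> V}"
    using U unfolding direct_summand_def by blast
  interpret U: subgroup U "add_monoid P" using U by (simp add: subbimodule_def)
  interpret V: subgroup V "add_monoid P" using V by (simp add: subbimodule_def)
  have UP: "u \<in> carrier P" if "u \<in> U" for u using that U.subset by auto
  have VP: "v \<in> carrier P" if "v \<in> V" for v using that V.subset by auto
  have bij: "bij_betw f (carrier M) U" using f by (simp add: bimodule_iso_def)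
  then have fU: "f m \<in> U" if "m \<in> carrier M" for m using that by (auto simp: bij_betw_def)
  note f_hom = bimodule_homD[OF bimodule_iso_imp_hom[OF f], simplified]
  \<comment> \<open>Components along \<open>U\<close> and \<open>V\<close> are unique because the
    two meet only in zero. This justifies the definite description that defines
    \<open>g\<close>.\<close>
  have uniq: "m = m'" if "m \<in> carrier M" "m' \<in> carrier M" "v \<in> V" "v' \<in> V"
    "f m \<oplus>\<^bsub>P\<^esub> v = f m' \<oplus>\<^bsub>P\<^esub> v'" for m m' v v'
  proof -
    have c: "f m \<in> carrier P" "f m' \<in> carrier P" "v \<in> carrier P" "v' \<in> carrier P"
      using that fU UP VP by auto
    have "f m = f m' \<oplus>\<^bsub>P\<^esub> v' \<oplus>\<^bsub>P\<^esub> \<ominus>\<^bsub>P\<^esub> v"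
      using that(5) c by (metis P.a_inv_closed P.a_assoc P.r_neg P.r_zero)
    then have "\<ominus>\<^bsub>P\<^esub> f m' \<oplus>\<^bsub>P\<^esub> f m = v' \<oplus>\<^bsub>P\<^esub> \<ominus>\<^bsub>P\<^esub> v"
      using c by (metis P.a_inv_closed P.a_assoc P.l_neg P.l_zero P.a_closed)
    moreover have "\<ominus>\<^bsub>P\<^esub> f m' \<oplus>\<^bsub>P\<^esub> f m \<in> U"
      using U.m_closed[OF U.m_inv_closed] fU that(1,2) by (simp add: a_inv_def)
    moreover have "v' \<oplus>\<^bsub>P\<^esub> \<ominus>\<^bsub>P\<^esub> v \<in> V"
      using V.m_closed[OF _ V.m_inv_closed] that(3,4) by (simp add: a_inv_def)
    ultimately have "\<ominus>\<^bsub>P\<^esub> f m' \<oplus>\<^bsub>P\<^esub> f m = \<zero>\<^bsub>P\<^esub>" using UV(1) by auto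
    then have "f m' = f m"
      using c by (metis P.minus_equality P.minus_minus P.a_inv_closed P.a_comm)
    then show ?thesis using bij that(1,2) by (metis bij_betw_inv_into_left)
  qed
  define g where "g x = (THE m. m \<in> carrier M \<and> (\<exists>v\<in>V. x = f m \<oplus>\<^bsub>P\<^esub> v))" for x
  have gI: "g (f m \<oplus>\<^bsub>P\<^esub> v) = m" if "m \<in> carrier M" "v \<in> V" for m v
    unfolding g_def using that uniq by blast
  have decomp: "\<exists>m\<in>carrier M. \<exists>v\<in>V. x = f m \<oplus>\<^bsub>P\<^esub> v" if "x \<in> carrier P" for x
    using that bij unfolding UV(2) bij_betw_def by blast
  have "g \<in> bimodule_hom A B P M"
    unfolding bimodule_hom_def
  proof (intro CollectI conjI ballI funcsetI)
    fix x assume "x \<in> carrier P"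
    then obtain m v where x: "m \<in> carrier M" "v \<in> V" "x = f m \<oplus>\<^bsub>P\<^esub> v" using decomp by blast
    then show "g x \<in> carrier M" by (simp add: gI)
    have fP: "f m \<in> carrier P" using x fU UP by simp
    show "g (lsmult P a x) = lsmult M a (g x)" if "a \<in> A" for a
    proof -
      have "lsmult P a v \<in> V" using V x that by (simp add: subbimodule_def)
      moreover have "lsmult P a x = f (lsmult M a m) \<oplus>\<^bsub>P\<^esub> lsmult P a v"
        using x that fP VP by (simp add: P.lsmult_add f_hom)
      ultimately show ?thesis using x that by (simp add: gI M.lsmult_closed)
    qed
    show "g (rsmult P x b) = rsmult M (g x) b" if "b \<in> B" for b
    proof -
      have "rsmult P v b \<in> V" using V x that by (simp add: subbimodule_def)
      moreover have "rsmult P x b = f (rsmult M m b) \<oplus>\<^bsub>P\<^esub> rsmult P v b"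
        using x that fP VP by (simp add: P.rsmult_add f_hom)
      ultimately show ?thesis using x that by (simp add: gI M.rsmult_closed)
    qed
    fix y assume "y \<in> carrier P"
    then obtain m' v' where y: "m' \<in> carrier M" "v' \<in> V" "y = f m' \<oplus>\<^bsub>P\<^esub> v'" using decomp by blast
    have "x \<oplus>\<^bsub>P\<^esub> y = f (m \<oplus>\<^bsub>M\<^esub> m') \<oplus>\<^bsub>P\<^esub> (v \<oplus>\<^bsub>P\<^esub> v')"
      using x y fU UP VP by (simp add: f_hom P.a_ac)
    moreover have "v \<oplus>\<^bsub>P\<^esub> v' \<in> V" using x y V.m_closed by simp
    ultimately show "g (x \<oplus>\<^bsub>P\<^esub> y) = g x \<oplus>\<^bsub>M\<^esub> g y" using x y by (simp add: gI)
  qed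
  moreover have "g (f m) = m" if "m \<in> carrier M" for m
    using gI[OF that, of "\<zero>\<^bsub>P\<^esub>"] V.one_closed fU[OF that] UP by simp
  ultimately show ?thesis by (rule that)
qed

lemma retract_imp_iso_to_summand_of_power:
  assumes "bimodule_on A B M" "bimodule_on A B N"
    and "f \<in> bimodule_hom A B M (bimodule_power N p)" "g \<in> bimodule_hom A B (bimodule_power N p) M"
    and "\<And>m. m \<in> carrier M \<Longrightarrow> g (f m) = m"
  shows "iso_to_summand_of_power A B M N p"
  unfolding iso_to_summand_of_power_def
  using retract_imp_direct_summand[OF assms(1) bimodule_power_bimodule[OF assms(2)] assms(3,4)] assms(5)
  by blast

text \<open>
  Every element of a summand \<open>M\<close> of \<open>N\<^sup>p\<close> is a sum of values of homomorphisms \<open>N \<rightarrow> M\<close>.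
\<close>

lemma summand_of_power_additive_eqI:
  fixes \<alpha> \<beta> :: "'m \<Rightarrow> 'w::ab_group_add"
  assumes M: "bimodule_on A B M" and N: "bimodule_on A B N"
    and MN: "iso_to_summand_of_power A B M N p"
    and \<alpha>: "\<And>x y. x \<in> carrier M \<Longrightarrow> y \<in> carrier M \<Longrightarrow> \<alpha> (x \<oplus>\<^bsub>M\<^esub> y) = \<alpha> x + \<alpha> y"
    and \<beta>: "\<And>x y. x \<in> carrier M \<Longrightarrow> y \<in> carrier M \<Longrightarrow> \<beta> (x \<oplus>\<^bsub>M\<^esub> y) = \<beta> x + \<beta> y"
    and eq: "\<And>\<psi> n. \<psi> \<in> bimodule_hom A B N M \<Longrightarrow> n \<in> carrier N \<Longrightarrow> \<alpha> (\<psi> n) = \<beta> (\<psi> n)"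
    and m: "m \<in> carrier M"
  shows "\<alpha> m = \<beta> m"
proof -
  interpret M: bimodule_on A B M by fact
  interpret N: bimodule_on A B N by fact
  let ?P = "bimodule_power N p"
  have P: "bimodule_on A B ?P" by (rule bimodule_power_bimodule[OF N])
  obtain U f where "direct_summand A B U ?P" and f: "f \<in> bimodule_iso A B M (?P\<lparr>carrier := U\<rparr>)"
    using MN unfolding iso_to_summand_of_power_def by blast
  then obtain g where g: "g \<in> bimodule_hom A B ?P M" and gf: "g (f m) = m"
    using direct_summand_imp_retract[OF M P] m by metis
  have "U \<subseteq> carrier ?P"
    using subgroup.subset[of U "add_monoid ?P"] \<open>direct_summand A B U ?P\<close>
    by (simp add: direct_summand_def subbimodule_def)
  moreover have "f m \<in> U" using f m by (auto simp: bimodule_iso_def bij_betw_def)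
  ultimately have x: "f m \<in> carrier ?P" by blast
  define x where "x = f m"
  have xi: "x i \<in> carrier N" if "i < p" for i
    using x that by (auto simp: bimodule_power_def x_def)
  define inj where "inj i n = (\<lambda>j\<in>{..<p}. if j = i then n else \<zero>\<^bsub>N\<^esub>)" for i :: nat and n
  have inj: "inj i \<in> bimodule_hom A B N ?P" for i
    unfolding bimodule_hom_def inj_def bimodule_power_def
    by (auto simp: PiE_iff N.lsmult_zero N.rsmult_zero intro!: restrict_ext)
  \<comment> \<open>The vector \<open>x\<close> is assembled one coordinate at a time. Passing from
    \<open>trunc k\<close> to \<open>trunc (Suc k)\<close> adds \<open>inj k (x k)\<close>, to which
    \<open>eq\<close> applies through the homomorphism \<open>g \<circ> inj k\<close> from
    \<open>N\<close> to \<open>M\<close>.\<close>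
  define trunc where "trunc k = (\<lambda>j\<in>{..<p}. if j < k then x j else \<zero>\<^bsub>N\<^esub>)" for k
  have "trunc k \<in> carrier ?P \<and> \<alpha> (g (trunc k)) = \<beta> (g (trunc k))" if "k \<le> p" for k
    using that
  proof (induction k)
    case 0
    have "trunc 0 = \<zero>\<^bsub>?P\<^esub>" by (simp add: trunc_def bimodule_power_def)
    moreover have "g \<zero>\<^bsub>?P\<^esub> = \<zero>\<^bsub>M\<^esub>"
      using group_hom.hom_one[OF bimodule_hom_group_hom[OF P M g]] by simp
    moreover have "\<alpha> \<zero>\<^bsub>M\<^esub> = 0" "\<beta> \<zero>\<^bsub>M\<^esub> = 0"
      using \<alpha>[of "\<zero>\<^bsub>M\<^esub>" "\<zero>\<^bsub>M\<^esub>"] \<beta>[of "\<zero>\<^bsub>M\<^esub>" "\<zero>\<^bsub>M\<^esub>"] by simp_all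
    moreover have "\<zero>\<^bsub>?P\<^esub> \<in> carrier ?P" by (simp add: bimodule_power_def)
    ultimately show ?case by simp
  next
    case (Suc k)
    have step: "trunc (Suc k) = trunc k \<oplus>\<^bsub>?P\<^esub> inj k (x k)"
      using Suc.prems xi unfolding trunc_def inj_def bimodule_power_def
      by (auto simp: fun_eq_iff less_Suc_eq)
    have "inj k (x k) \<in> carrier ?P" "(g \<circ> inj k) (x k) \<in> carrier M"
      using bimodule_homD(1)[OF inj xi] bimodule_homD(1)[OF bimodule_hom_comp[OF inj g] xi] Suc.prems
      by auto
    moreover have "\<alpha> ((g \<circ> inj k) (x k)) = \<beta> ((g \<circ> inj k) (x k))"
      using eq[OF bimodule_hom_comp[OF inj g] xi] Suc.prems by simp
    moreover have "trunc (Suc k) \<in> carrier ?P"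
      using xi by (auto simp: trunc_def bimodule_power_def)
    ultimately show ?case
      using Suc bimodule_homD(1,2)[OF g] by (auto simp: step \<alpha> \<beta>)
  qed
  moreover have "trunc p = x"
    using x by (auto simp: trunc_def x_def bimodule_power_def PiE_iff extensional_def fun_eq_iff)
  ultimately show ?thesis using gf x_def by fastforce
qed


section \<open>Additive functionals on tensor powers\<close>

locale tensor_ring = ring H for H :: "('h, 'c) ring_scheme" (structure) +
  fixes R :: "'h set"
  assumes R_subring: "subring R H"
begin

lemmas R_subset = subringE(1)[OF R_subring]

section \<open>Elements and bimodule structure of the tensor powers\<close>

definition tensors :: "nat \<Rightarrow> 'h list set" where
  "tensors n = {xs. length xs = n \<and> set xs \<subseteq> carrier H}"

definition coset :: "nat \<Rightarrow> ('h list \<Rightarrow>\<^sub>0 int) \<Rightarrow> ('h list \<Rightarrow>\<^sub>0 int) set" where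
  "coset n c = tensor_null H R n #>\<^bsub>tensor_free H n\<^esub> c"

text \<open>The elementary tensor of the entries of \<open>xs\<close>.\<close>

abbreviation pure :: "'h list \<Rightarrow> ('h list \<Rightarrow>\<^sub>0 int) set" where
  "pure xs \<equiv> coset (length xs) (frag_of xs)"

lemma tensor_free_carrier:
  "c \<in> carrier (tensor_free H n) \<longleftrightarrow> Poly_Mapping.keys c \<subseteq> tensors n"
  by (simp add: tensor_free_def tensors_def free_Abelian_group_def)

lemma tensor_free_mult [simp]: "x \<otimes>\<^bsub>tensor_free H n\<^esub> y = x + y"
  by (simp add: tensor_free_def)

lemma tensor_free_comm_group: "comm_group (tensor_free H n)"
  unfolding tensor_free_def by (rule abelian_free_Abelian_group)

lemma null_subgroup: "subgroup (tensor_null H R n) (tensor_free H n)"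
  by (rule tensor_null_subgroup[OF ring_axioms R_subset])

lemma null_normal: "tensor_null H R n \<lhd> tensor_free H n"
proof -
  interpret comm_group "tensor_free H n" by (rule tensor_free_comm_group)
  show ?thesis by (rule subgroup_imp_normal[OF null_subgroup])
qed

lemma tensor_power_carrier:
  "carrier (tensor_power H R n) = coset n ` carrier (tensor_free H n)"
  by (auto simp: tensor_power_def Let_def FactGroup_def RCOSETS_def coset_def)

lemma coset_add:
  assumes "c \<in> carrier (tensor_free H n)" "d \<in> carrier (tensor_free H n)"
  shows "coset n c \<oplus>\<^bsub>tensor_power H R n\<^esub> coset n d = coset n (c + d)"
  using normal.rcos_sum[OF null_normal assms]
  by (simp add: tensor_power_def Let_def FactGroup_def coset_def)

lemma frag_extend_closed:
  assumes "\<And>xs. xs \<in> tensors n \<Longrightarrow> g xs \<in> tensors n"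
    and "c \<in> carrier (tensor_free H n)"
  shows "frag_extend (\<lambda>xs. frag_of (g xs)) c \<in> carrier (tensor_free H n)"
  using keys_frag_extend[of "\<lambda>xs. frag_of (g xs)" c] assms
  by (fastforce simp: tensor_free_carrier)

text \<open>Positivity of \<open>n\<close> matters: on the empty list, multiplying the first or the
  last entry would return a list of length one.\<close>

lemma lmult_first_tensors:
  "n > 0 \<Longrightarrow> a \<in> carrier H \<Longrightarrow> xs \<in> tensors n \<Longrightarrow> lmult_first H a xs \<in> tensors n"
  by (cases xs) (auto simp: tensors_def lmult_first_def)

lemma rmult_last_tensors:
  "n > 0 \<Longrightarrow> a \<in> carrier H \<Longrightarrow> xs \<in> tensors n \<Longrightarrow> rmult_last H a xs \<in> tensors n"
  by (cases xs rule: rev_cases) (auto simp: tensors_def rmult_last_def)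

lemmas lsmult_coset = tensor_power_lsmult_coset[OF ring_axioms R_subset, folded coset_def]
lemmas rsmult_coset = tensor_power_rsmult_coset[OF ring_axioms R_subset, folded coset_def]

lemma tensor_power_bimodule:
  assumes n: "n > 0"
  shows "bimodule_on (carrier H) (carrier H) (tensor_power H R n)"
proof (rule bimodule_on.intro)
  interpret F: comm_group "tensor_free H n" by (rule tensor_free_comm_group)
  interpret Q: comm_group "tensor_free H n Mod tensor_null H R n"
    by (rule F.abelian_FactGroup[OF null_subgroup])
  have eqs: "carrier (tensor_power H R n) = carrier (tensor_free H n Mod tensor_null H R n)"
    "\<zero>\<^bsub>tensor_power H R n\<^esub> = \<one>\<^bsub>tensor_free H n Mod tensor_null H R n\<^esub>"
    "x \<oplus>\<^bsub>tensor_power H R n\<^esub> y = x \<otimes>\<^bsub>tensor_free H n Mod tensor_null H R n\<^esub> y" for x y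
    by (simp_all add: tensor_power_def Let_def)
  show "abelian_group (tensor_power H R n)"
    by (rule abelian_groupI; unfold eqs)
       (erule Q.m_closed Q.m_assoc Q.m_comm Q.l_one Q.l_inv_ex | rule Q.one_closed | assumption)+
  note closed = frag_extend_closed[OF lmult_first_tensors[OF n]]
    frag_extend_closed[OF rmult_last_tensors[OF n]]
  show "bimodule_on_axioms (carrier H) (carrier H) (tensor_power H R n)"
    by unfold_locales
       (use closed F.m_closed in \<open>auto simp: tensor_power_carrier lsmult_coset rsmult_coset coset_add
          frag_extend_add\<close>)
qed

lemma pure_closed: "xs \<in> tensors n \<Longrightarrow> pure xs \<in> carrier (tensor_power H R n)"
  by (auto simp: tensor_power_carrier tensors_def tensor_free_carrier)

lemma lsmult_pure: "a \<in> carrier H \<Longrightarrow> lsmult (tensor_power H R (Suc n)) a (coset (Suc n) (frag_of (x # xs)))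
    = coset (Suc n) (frag_of ((a \<otimes> x) # xs))"
  by (simp add: lsmult_coset lmult_first_def)

lemma rsmult_pure: "b \<in> carrier H \<Longrightarrow> rsmult (tensor_power H R (Suc n)) (coset (Suc n) (frag_of (xs @ [x]))) b
    = coset (Suc n) (frag_of (xs @ [x \<otimes> b]))"
  by (simp add: rsmult_coset rmult_last_def)

section \<open>Additive maps out of the tensor powers\<close>

text \<open>Elementary tensors generate the tensor power as a group, since a representative is an
  integral combination of lists; the induction runs over such combinations.\<close>

lemma tensor_power_additive_eqI:
  fixes \<alpha> \<beta> :: "('h list \<Rightarrow>\<^sub>0 int) set \<Rightarrow> 'w::ab_group_add"
  assumes \<alpha>: "\<And>X Y. X \<in> carrier (tensor_power H R n) \<Longrightarrow> Y \<in> carrier (tensor_power H R n) \<Longrightarrow>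
      \<alpha> (X \<oplus>\<^bsub>tensor_power H R n\<^esub> Y) = \<alpha> X + \<alpha> Y"
    and \<beta>: "\<And>X Y. X \<in> carrier (tensor_power H R n) \<Longrightarrow> Y \<in> carrier (tensor_power H R n) \<Longrightarrow>
      \<beta> (X \<oplus>\<^bsub>tensor_power H R n\<^esub> Y) = \<beta> X + \<beta> Y"
    and eq: "\<And>xs. xs \<in> tensors n \<Longrightarrow> \<alpha> (coset n (frag_of xs)) = \<beta> (coset n (frag_of xs))"
    and X: "X \<in> carrier (tensor_power H R n)"
  shows "\<alpha> X = \<beta> X"
proof -
  interpret F: comm_group "tensor_free H n" by (rule tensor_free_comm_group)
  obtain c where c: "c \<in> carrier (tensor_free H n)" "X = coset n c"
    using X by (auto simp: tensor_power_carrier)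
  have add: "\<alpha> (coset n (c + d)) = \<alpha> (coset n c) + \<alpha> (coset n d)"
    "\<beta> (coset n (c + d)) = \<beta> (coset n c) + \<beta> (coset n d)"
    if "c \<in> carrier (tensor_free H n)" "d \<in> carrier (tensor_free H n)" for c d
    using that \<alpha>[of "coset n c" "coset n d"] \<beta>[of "coset n c" "coset n d"]
    by (simp_all add: coset_add tensor_power_carrier)
  have "Poly_Mapping.keys c \<subseteq> tensors n"
    using c by (simp add: tensor_free_carrier)
  then have "c \<in> carrier (tensor_free H n) \<and> \<alpha> (coset n c) = \<beta> (coset n c)"
  proof (induction rule: frag_induction)
    case zero
    have "(0 :: 'h list \<Rightarrow>\<^sub>0 int) \<in> carrier (tensor_free H n)"
      by (simp add: tensor_free_carrier)
    then show ?case using add[of 0 0] by simp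
  next
    case (one xs)
    then show ?case by (simp add: eq tensor_free_carrier)
  next
    case (diff c d)
    then have cd: "c - d \<in> carrier (tensor_free H n)"
      by (auto simp: tensor_free_carrier dest!: subsetD[OF keys_diff])
    with diff add[of "c - d" d] show ?case by simp
  qed
  with c show ?thesis by simp
qed

text \<open>The universal property: \<open>t\<close> extends to the free abelian group, and its
  additivity and balancing make the extension vanish on all relators, so that it descends to the
  quotient.\<close>

lemma tensor_power_universal:
  fixes t :: "'h list \<Rightarrow> 'w::ab_group_add"
  assumes t_add: "\<And>us vs x y. us @ [x] @ vs \<in> tensors n \<Longrightarrow> y \<in> carrier H \<Longrightarrow>
      t (us @ [x \<oplus> y] @ vs) = t (us @ [x] @ vs) + t (us @ [y] @ vs)"
    and t_bal: "\<And>us vs x y r. us @ [x, y] @ vs \<in> tensors n \<Longrightarrow> r \<in> R \<Longrightarrow>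
      t (us @ [x \<otimes> r, y] @ vs) = t (us @ [x, r \<otimes> y] @ vs)"
  obtains T where
    "\<And>X Y. X \<in> carrier (tensor_power H R n) \<Longrightarrow> Y \<in> carrier (tensor_power H R n) \<Longrightarrow>
      T (X \<oplus>\<^bsub>tensor_power H R n\<^esub> Y) = T X + T Y"
    "\<And>xs. xs \<in> tensors n \<Longrightarrow> T (coset n (frag_of xs)) = t xs"
proof -
  \<comment> \<open>The additive group of the target type, packaged as a record so that the
    universal property of the free abelian group applies to it.\<close>
  define W where "W = \<lparr>carrier = UNIV :: 'w set, monoid.mult = (+), one = 0 :: 'w\<rparr>"
  interpret W: comm_group W
  proof (rule comm_groupI)
    show "\<exists>y\<in>carrier W. y \<otimes>\<^bsub>W\<^esub> x = \<one>\<^bsub>W\<^esub>" for x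
      by (auto simp: W_def intro: exI[of _ "- x"])
  qed (auto simp: W_def algebra_simps)
  interpret F: comm_group "tensor_free H n" by (rule tensor_free_comm_group)
  interpret N: subgroup "tensor_null H R n" "tensor_free H n" by (rule null_subgroup)
  obtain e where "e \<in> hom (free_Abelian_group (tensors n)) W"
    and e_of: "\<And>xs. xs \<in> tensors n \<Longrightarrow> e (frag_of xs) = t xs"
    by (rule W.free_Abelian_group_universal[of t "tensors n"]) (auto simp: W_def)
  then have e_hom: "e \<in> hom (tensor_free H n) W"
    by (simp add: tensor_free_def tensors_def)
  interpret e: group_hom "tensor_free H n" W e
    by unfold_locales (rule e_hom)
  have e_add: "e (c + d) = e c + e d"
    if "c \<in> carrier (tensor_free H n)" "d \<in> carrier (tensor_free H n)" for c d
    using e.hom_mult[OF that] by (simp add: W_def)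
  have e_diff: "e (c - d) = e c - e d"
    if "c \<in> carrier (tensor_free H n)" "d \<in> carrier (tensor_free H n)" for c d
  proof -
    have "c - d \<in> carrier (tensor_free H n)"
      using that by (auto simp: tensor_free_carrier dest!: subsetD[OF keys_diff])
    from e_add[OF this that(2)] show ?thesis by simp
  qed
  have of_closed: "frag_of xs \<in> carrier (tensor_free H n)" if "xs \<in> tensors n" for xs
    using that by (simp add: tensor_free_carrier)
  have of_diff: "frag_of xs - frag_of ys \<in> carrier (tensor_free H n)"
    if "xs \<in> tensors n" "ys \<in> tensors n" for xs ys
    using that by (auto simp: tensor_free_carrier dest!: subsetD[OF keys_diff])
  have "tensor_relators H R n \<subseteq> kernel (tensor_free H n) W e"
  proof
    fix c assume c: "c \<in> tensor_relators H R n"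
    then have cF: "c \<in> carrier (tensor_free H n)"
      using tensor_relators_subset[OF ring_axioms R_subset] by blast
    from c consider
      (add) us vs x y where
        "c = frag_of (us @ [x \<oplus> y] @ vs) - frag_of (us @ [x] @ vs) - frag_of (us @ [y] @ vs)"
        "us @ [x] @ vs \<in> tensors n" "us @ [y] @ vs \<in> tensors n" "us @ [x \<oplus> y] @ vs \<in> tensors n"
        "y \<in> carrier H"
    | (bal) us vs x y r where
        "c = frag_of (us @ [x \<otimes> r, y] @ vs) - frag_of (us @ [x, r \<otimes> y] @ vs)"
        "us @ [x, y] @ vs \<in> tensors n" "r \<in> R"
        "us @ [x \<otimes> r, y] @ vs \<in> tensors n" "us @ [x, r \<otimes> y] @ vs \<in> tensors n"
      using R_subset unfolding tensor_relators_def tensors_def by fastforce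
    then have "e c = 0"
    proof cases
      case add
      then have "e c = t (us @ [x \<oplus> y] @ vs) - t (us @ [x] @ vs) - t (us @ [y] @ vs)"
        by (simp only: e_diff e_of of_closed of_diff)
      then show ?thesis using t_add[OF add(2,5)] by simp
    next
      case bal
      then have "e c = t (us @ [x \<otimes> r, y] @ vs) - t (us @ [x, r \<otimes> y] @ vs)"
        by (simp only: e_diff e_of of_closed)
      then show ?thesis using t_bal[OF bal(2,3)] by simp
    qed
    with cF show "c \<in> kernel (tensor_free H n) W e"
      by (simp add: kernel_def W_def)
  qed
  then have "tensor_null H R n \<subseteq> kernel (tensor_free H n) W e"
    unfolding tensor_null_def by (rule F.generate_subgroup_incl) (rule e.subgroup_kernel)
  then have e_null: "e d = 0" if "d \<in> tensor_null H R n" for d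
    using that by (auto simp: kernel_def W_def)
  \<comment> \<open>The choice of a representative is immaterial, because two of them differ by an
    element of the null subgroup, on which \<open>e\<close> vanishes.\<close>
  define T where "T X = e (SOME c. c \<in> X)" for X
  have T_coset: "T (coset n c) = e c" if c: "c \<in> carrier (tensor_free H n)" for c
  proof -
    have "c \<in> coset n c"
      unfolding coset_def by (rule F.rcos_self[OF c N.subgroup_axioms])
    then have "(SOME d. d \<in> coset n c) \<in> coset n c" by (rule someI)
    then obtain d where "d \<in> tensor_null H R n" "(SOME d. d \<in> coset n c) = d + c"
      by (auto simp: coset_def r_coset_def)
    then show ?thesis using c by (simp add: T_def e_add e_null)
  qed
  show ?thesis
  proof
    show "T (X \<oplus>\<^bsub>tensor_power H R n\<^esub> Y) = T X + T Y"
      if "X \<in> carrier (tensor_power H R n)" "Y \<in> carrier (tensor_power H R n)" for X Y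
      using that F.m_closed by (auto simp: tensor_power_carrier coset_add T_coset e_add)
    show "T (coset n (frag_of xs)) = t xs" if "xs \<in> tensors n" for xs
      using that by (simp add: T_coset of_closed e_of)
  qed
qed

end


section \<open>Consequences of small depth\<close>

text \<open>The argument common to depth 1, where \<open>B\<close> is the subring, and to the
  left-handed depth 2, where \<open>B\<close> is the whole ring. Since \<open>N\<close> is cyclic on
  \<open>e\<close>, a homomorphism \<open>\<psi>\<close> satisfies
  \<open>a \<psi>(e b) = \<psi>(e) (a b)\<close>. Applying \<open>\<phi>\<close> yields the factor
  \<open>\<epsilon> a\<close>, and values of such \<open>\<psi>\<close> generate \<open>M\<close>
  additively.\<close>

lemma cyclic_summand_functional:
  fixes H (structure) and \<phi> :: "'m \<Rightarrow> 'k::comm_ring_1"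
  assumes M: "bimodule_on A B M" and N: "bimodule_on A B N"
    and MN: "iso_to_summand_of_power A B M N p"
    and AB: "A \<subseteq> B" and B: "\<And>a b. a \<in> A \<Longrightarrow> b \<in> B \<Longrightarrow> a \<otimes> b \<in> B"
    and e: "e \<in> carrier N" "\<And>n. n \<in> carrier N \<Longrightarrow> \<exists>b\<in>B. n = rsmult N e b"
      "\<And>a b. a \<in> A \<Longrightarrow> b \<in> B \<Longrightarrow> lsmult N a (rsmult N e b) = rsmult N e (a \<otimes> b)"
    and \<epsilon>: "\<And>a b. a \<in> A \<Longrightarrow> b \<in> B \<Longrightarrow> \<epsilon> (a \<otimes> b) = \<epsilon> a * \<epsilon> b"
    and \<phi>_add: "\<And>x y. x \<in> carrier M \<Longrightarrow> y \<in> carrier M \<Longrightarrow> \<phi> (x \<oplus>\<^bsub>M\<^esub> y) = \<phi> x + \<phi> y"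
    and \<phi>_r: "\<And>b m. b \<in> B \<Longrightarrow> m \<in> carrier M \<Longrightarrow> \<phi> (rsmult M m b) = \<phi> m * \<epsilon> b"
    and am: "a \<in> A" "m \<in> carrier M"
  shows "\<phi> (lsmult M a m) = \<epsilon> a * \<phi> m"
proof -
  interpret M: bimodule_on A B M by fact
  interpret N: bimodule_on A B N by fact
  show ?thesis
  proof (rule summand_of_power_additive_eqI[OF M N MN, where m = m])
    fix \<psi> n assume \<psi>: "\<psi> \<in> bimodule_hom A B N M" and n: "n \<in> carrier N"
    note h = bimodule_homD[OF \<psi>]
    obtain b where b: "b \<in> B" "n = rsmult N e b" using e n by blast
    have "lsmult M a (\<psi> n) = \<psi> (lsmult N a n)" using am n by (simp add: h)
    also have "\<dots> = rsmult M (\<psi> e) (a \<otimes> b)" using am b by (simp add: h e B)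
    finally have "\<phi> (lsmult M a (\<psi> n)) = \<phi> (\<psi> e) * (\<epsilon> a * \<epsilon> b)"
      using am b by (simp add: \<phi>_r h e B \<epsilon>)
    moreover have "\<phi> (\<psi> n) = \<phi> (\<psi> e) * \<epsilon> b" using b by (simp add: \<phi>_r h e)
    ultimately show "\<phi> (lsmult M a (\<psi> n)) = \<epsilon> a * \<phi> (\<psi> n)" by (simp add: algebra_simps)
  qed (use am in \<open>auto simp: M.lsmult_add M.lsmult_closed \<phi>_add distrib_left\<close>)
qed

context tensor_ring
begin

section \<open>Subrings as bimodules, and tensors with one or two factors\<close>

lemma mult_bimodule_bimodule:
  assumes S: "subring S H"
  shows "bimodule_on S S (mult_bimodule H S)"
proof (rule bimodule_on.intro)
  note S_sub = subringE[OF S]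
  have sub: "x \<in> carrier H" if "x \<in> S" for x using S_sub(1) that by blast
  show "abelian_group (mult_bimodule H S)"
  proof (rule abelian_groupI)
    fix x assume "x \<in> carrier (mult_bimodule H S)"
    then show "\<exists>y\<in>carrier (mult_bimodule H S). y \<oplus>\<^bsub>mult_bimodule H S\<^esub> x = \<zero>\<^bsub>mult_bimodule H S\<^esub>"
      by (intro bexI[of _ "\<ominus> x"]) (auto simp: mult_bimodule_def sub S_sub l_neg)
  qed (auto simp: mult_bimodule_def sub S_sub a_ac)
  show "bimodule_on_axioms S S (mult_bimodule H S)"
    by unfold_locales (auto simp: mult_bimodule_def sub S_sub r_distr l_distr)
qed

lemma tensor_power_1_iso':
  "(\<lambda>x. coset 1 (frag_of [x])) \<in>
    bimodule_iso (carrier H) (carrier H) (mult_bimodule H (carrier H)) (tensor_power H R 1)"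
  using tensor_power_1_iso[OF ring_axioms R_subset] by (simp add: coset_def)

lemma tensor_power_1_cases:
  assumes "X \<in> carrier (tensor_power H R 1)"
  obtains x where "x \<in> carrier H" "X = coset 1 (frag_of [x])"
proof -
  have "(\<lambda>x. coset 1 (frag_of [x])) ` carrier H = carrier (tensor_power H R 1)"
    using tensor_power_1_iso' by (simp add: bimodule_iso_def bij_betw_def mult_bimodule_def)
  with assms show ?thesis by (blast intro: that)
qed

lemma tensors_2_cases:
  assumes "xs \<in> tensors 2"
  obtains x y where "xs = [x, y]" "x \<in> carrier H" "y \<in> carrier H"
  using assms by (auto simp: tensors_def numeral_2_eq_2 length_Suc_conv)

section \<open>What depth 1 and depth 2 impose on functionals\<close>

text \<open>Here \<open>q\<close> itself, transported to the tensor power with one factor, serves as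
  the functional, and \<open>R\<close> is cyclic on \<open>\<one>\<close>.\<close>

lemma depth_1_functional:
  fixes \<epsilon> q :: "'h \<Rightarrow> 'k::comm_ring_1"
  assumes MN: "iso_to_summand_of_power R R (tensor_power H R 1) (mult_bimodule H R) p"
    and \<epsilon>_mult: "\<And>x y. x \<in> R \<Longrightarrow> y \<in> R \<Longrightarrow> \<epsilon> (x \<otimes> y) = \<epsilon> x * \<epsilon> y"
    and q_add: "\<And>x y. x \<in> carrier H \<Longrightarrow> y \<in> carrier H \<Longrightarrow> q (x \<oplus> y) = q x + q y"
    and q_R: "\<And>x r. x \<in> carrier H \<Longrightarrow> r \<in> R \<Longrightarrow> q (x \<otimes> r) = q x * \<epsilon> r"
    and rh: "r \<in> R" "h \<in> carrier H"
  shows "q (r \<otimes> h) = \<epsilon> r * q h"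
proof -
  note R_sub = subringE[OF R_subring]
  have sub: "x \<in> carrier H" if "x \<in> R" for x using R_sub(1) that by blast
  have M: "bimodule_on R R (tensor_power H R 1)"
    by (rule bimodule_on_mono[OF tensor_power_bimodule]) (use R_sub in auto)
  \<comment> \<open>In a list of length one nothing surrounds the entry, so additivity reduces to
    that of \<open>q\<close>, and the balancing condition is vacuous.\<close>
  have t1: "us = [] \<and> vs = [] \<and> x \<in> carrier H" if "us @ x # vs \<in> tensors 1" for us vs x
    using that by (auto simp: tensors_def)
  obtain T where T_add: "\<And>X Y. X \<in> carrier (tensor_power H R 1) \<Longrightarrow> Y \<in> carrier (tensor_power H R 1) \<Longrightarrow>
      T (X \<oplus>\<^bsub>tensor_power H R 1\<^esub> Y) = T X + T Y"
    and "\<And>xs. xs \<in> tensors 1 \<Longrightarrow> T (coset 1 (frag_of xs)) = q (hd xs)"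
    by (rule tensor_power_universal[of 1 "\<lambda>xs. q (hd xs)"]) (auto dest!: t1 simp: q_add tensors_def)
  then have T: "T (coset 1 (frag_of [x])) = q x" if "x \<in> carrier H" for x
    using that by (force simp: tensors_def)
  have "T (lsmult (tensor_power H R 1) r (coset 1 (frag_of [h]))) = \<epsilon> r * T (coset 1 (frag_of [h]))"
  proof (rule cyclic_summand_functional[where H = H and e = \<one>, OF M mult_bimodule_bimodule[OF R_subring] MN])
    fix b X assume b: "b \<in> R" and "X \<in> carrier (tensor_power H R 1)"
    then obtain x where x: "x \<in> carrier H" "X = coset 1 (frag_of [x])"
      by (blast elim: tensor_power_1_cases)
    then show "T (rsmult (tensor_power H R 1) X b) = T X * \<epsilon> b"
      using b T[of x] T[of "x \<otimes> b"] rsmult_pure[of b 0 "[]" x] by (simp add: sub q_R)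
  next
    show "\<exists>b\<in>R. n = rsmult (mult_bimodule H R) \<one> b" if "n \<in> carrier (mult_bimodule H R)" for n
      using that sub by (auto simp: mult_bimodule_def)
  qed (use rh in \<open>auto simp: mult_bimodule_def sub R_sub \<epsilon>_mult T_add[unfolded One_nat_def]
      tensors_def intro: pure_closed[of "[h]" 1, simplified]\<close>)
  then show ?thesis
    using rh lsmult_pure[of r 0 h "[]"] T[of h] T[of "r \<otimes> h"] by (simp add: sub)
qed

text \<open>The functional sends \<open>x \<otimes> y\<close> to \<open>q x * \<epsilon> y\<close>.
  It is balanced because moving \<open>r\<close> across the tensor sign gives
  \<open>q x * \<epsilon> r * \<epsilon> y\<close> either way, and right multiplication by any ring
  element \<open>b\<close> scales it by \<open>\<epsilon> b\<close>. At the tensor of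
  \<open>h\<close> and \<open>\<one>\<close> it returns \<open>q h\<close>.\<close>

lemma depth_2_left_functional:
  fixes \<epsilon> q :: "'h \<Rightarrow> 'k::comm_ring_1"
  assumes MN: "iso_to_summand_of_power R (carrier H) (tensor_power H R 2) (tensor_power H R 1) p"
    and \<epsilon>_add: "\<And>x y. x \<in> carrier H \<Longrightarrow> y \<in> carrier H \<Longrightarrow> \<epsilon> (x \<oplus> y) = \<epsilon> x + \<epsilon> y"
    and \<epsilon>_mult: "\<And>x y. x \<in> carrier H \<Longrightarrow> y \<in> carrier H \<Longrightarrow> \<epsilon> (x \<otimes> y) = \<epsilon> x * \<epsilon> y"
    and \<epsilon>_one: "\<epsilon> \<one> = 1"
    and q_add: "\<And>x y. x \<in> carrier H \<Longrightarrow> y \<in> carrier H \<Longrightarrow> q (x \<oplus> y) = q x + q y"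
    and q_R: "\<And>x r. x \<in> carrier H \<Longrightarrow> r \<in> R \<Longrightarrow> q (x \<otimes> r) = q x * \<epsilon> r"
    and rh: "r \<in> R" "h \<in> carrier H"
  shows "q (r \<otimes> h) = \<epsilon> r * q h"
proof -
  have sub: "x \<in> carrier H" if "x \<in> R" for x using R_subset that by blast
  have M: "bimodule_on R (carrier H) (tensor_power H R 2)" "bimodule_on R (carrier H) (tensor_power H R 1)"
    by (rule bimodule_on_mono[OF tensor_power_bimodule]; use R_subset in simp)+
  interpret M: bimodule_on R "carrier H" "tensor_power H R 2" by (rule M)
  define t where "t xs = q (xs ! 0) * \<epsilon> (xs ! 1)" for xs
  obtain T where T_add: "\<And>X Y. X \<in> carrier (tensor_power H R 2) \<Longrightarrow> Y \<in> carrier (tensor_power H R 2) \<Longrightarrow>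
      T (X \<oplus>\<^bsub>tensor_power H R 2\<^esub> Y) = T X + T Y"
    and T_t: "\<And>xs. xs \<in> tensors 2 \<Longrightarrow> T (coset 2 (frag_of xs)) = t xs"
  proof (rule tensor_power_universal[of 2 t])
    fix us vs x y assume "us @ [x] @ vs \<in> tensors 2" "y \<in> carrier H"
    then show "t (us @ [x \<oplus> y] @ vs) = t (us @ [x] @ vs) + t (us @ [y] @ vs)"
      by (cases us; cases vs) (auto simp: tensors_def t_def q_add \<epsilon>_add algebra_simps)
  next
    fix us vs x y r assume "us @ [x, y] @ vs \<in> tensors 2" "r \<in> R"
    then show "t (us @ [x \<otimes> r, y] @ vs) = t (us @ [x, r \<otimes> y] @ vs)"
      by (cases us; cases vs) (auto simp: tensors_def t_def q_R \<epsilon>_mult sub)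
  qed (rule that)
  have T: "T (coset 2 (frag_of [x, y])) = q x * \<epsilon> y" if "x \<in> carrier H" "y \<in> carrier H" for x y
    using T_t[of "[x, y]"] that by (simp add: tensors_def t_def)
  have T_r: "T (rsmult (tensor_power H R 2) X b) = T X * \<epsilon> b"
    if "b \<in> carrier H" "X \<in> carrier (tensor_power H R 2)" for X b
    using that(2)
  proof (rule tensor_power_additive_eqI[rotated 3])
    fix xs assume "xs \<in> tensors 2"
    then obtain x y where xs: "xs = [x, y]" "x \<in> carrier H" "y \<in> carrier H"
      by (rule tensors_2_cases)
    have "rsmult (tensor_power H R 2) (coset 2 (frag_of [x, y])) b = coset 2 (frag_of [x, y \<otimes> b])"
      using that(1) rsmult_pure[of b 1 "[x]" y] by (simp add: numeral_2_eq_2)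
    then show "T (rsmult (tensor_power H R 2) (coset 2 (frag_of xs)) b) = T (coset 2 (frag_of xs)) * \<epsilon> b"
      using that(1) xs by (simp add: T \<epsilon>_mult)
  qed (use that(1) in \<open>simp_all add: M.rsmult_add M.rsmult_closed T_add distrib_right\<close>)
  have h1: "coset 2 (frag_of [h, \<one>]) \<in> carrier (tensor_power H R 2)"
    using pure_closed[of "[h, \<one>]" 2] rh by (simp add: tensors_def numeral_2_eq_2)
  have "T (lsmult (tensor_power H R 2) r (coset 2 (frag_of [h, \<one>]))) = \<epsilon> r * T (coset 2 (frag_of [h, \<one>]))"
  proof (rule cyclic_summand_functional[where H = H and e = "coset 1 (frag_of [\<one>])", OF M MN R_subset])
    show "coset 1 (frag_of [\<one>]) \<in> carrier (tensor_power H R 1)"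
      using pure_closed[of "[\<one>]" 1] by (simp add: tensors_def)
    show "\<exists>b\<in>carrier H. n = rsmult (tensor_power H R 1) (coset 1 (frag_of [\<one>])) b"
      if "n \<in> carrier (tensor_power H R 1)" for n
    proof -
      from that obtain x where "x \<in> carrier H" "n = coset 1 (frag_of [x])" by (rule tensor_power_1_cases)
      then show ?thesis using rsmult_pure[of x 0 "[]" \<one>] by (auto intro!: bexI[of _ x])
    qed
    show "lsmult (tensor_power H R 1) a (rsmult (tensor_power H R 1) (coset 1 (frag_of [\<one>])) b) =
      rsmult (tensor_power H R 1) (coset 1 (frag_of [\<one>])) (a \<otimes> b)" if "a \<in> R" "b \<in> carrier H" for a b
      using that rsmult_pure[of _ 0 "[]" \<one>] lsmult_pure[of a 0 b "[]"] by (simp add: sub)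
  qed (use rh in \<open>auto simp: sub \<epsilon>_mult T_add T_r h1\<close>)
  then show ?thesis using rh lsmult_pure[of r 1 h "[\<one>]"]
    by (simp add: sub T[unfolded numeral_2_eq_2] \<epsilon>_one numeral_2_eq_2)
qed

text \<open>The mirror image: the functional is \<open>\<epsilon> x * q y\<close>, it is linear for
  the left action, and it is evaluated at the tensor of \<open>\<one>\<close> and \<open>h\<close>.
  Now the ring is cyclic on \<open>\<one>\<close> as a left module.\<close>

lemma depth_2_right_functional:
  fixes \<epsilon> q :: "'h \<Rightarrow> 'k::comm_ring_1"
  assumes MN: "iso_to_summand_of_power (carrier H) R (tensor_power H R 2) (tensor_power H R 1) p"
    and \<epsilon>_add: "\<And>x y. x \<in> carrier H \<Longrightarrow> y \<in> carrier H \<Longrightarrow> \<epsilon> (x \<oplus> y) = \<epsilon> x + \<epsilon> y"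
    and \<epsilon>_mult: "\<And>x y. x \<in> carrier H \<Longrightarrow> y \<in> carrier H \<Longrightarrow> \<epsilon> (x \<otimes> y) = \<epsilon> x * \<epsilon> y"
    and \<epsilon>_one: "\<epsilon> \<one> = 1"
    and q_add: "\<And>x y. x \<in> carrier H \<Longrightarrow> y \<in> carrier H \<Longrightarrow> q (x \<oplus> y) = q x + q y"
    and q_R: "\<And>x r. x \<in> carrier H \<Longrightarrow> r \<in> R \<Longrightarrow> q (r \<otimes> x) = \<epsilon> r * q x"
    and rh: "r \<in> R" "h \<in> carrier H"
  shows "q (h \<otimes> r) = q h * \<epsilon> r"
proof -
  have sub: "x \<in> carrier H" if "x \<in> R" for x using R_subset that by blast
  have M: "bimodule_on (carrier H) R (tensor_power H R 2)" "bimodule_on (carrier H) R (tensor_power H R 1)"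
    by (rule bimodule_on_mono[OF tensor_power_bimodule]; use R_subset in simp)+
  interpret M: bimodule_on "carrier H" R "tensor_power H R 2" by (rule M)
  define t where "t xs = \<epsilon> (xs ! 0) * q (xs ! 1)" for xs
  obtain T where T_add: "\<And>X Y. X \<in> carrier (tensor_power H R 2) \<Longrightarrow> Y \<in> carrier (tensor_power H R 2) \<Longrightarrow>
      T (X \<oplus>\<^bsub>tensor_power H R 2\<^esub> Y) = T X + T Y"
    and T_t: "\<And>xs. xs \<in> tensors 2 \<Longrightarrow> T (coset 2 (frag_of xs)) = t xs"
  proof (rule tensor_power_universal[of 2 t])
    fix us vs x y assume "us @ [x] @ vs \<in> tensors 2" "y \<in> carrier H"
    then show "t (us @ [x \<oplus> y] @ vs) = t (us @ [x] @ vs) + t (us @ [y] @ vs)"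
      by (cases us; cases vs) (auto simp: tensors_def t_def q_add \<epsilon>_add algebra_simps)
  next
    fix us vs x y r assume "us @ [x, y] @ vs \<in> tensors 2" "r \<in> R"
    then show "t (us @ [x \<otimes> r, y] @ vs) = t (us @ [x, r \<otimes> y] @ vs)"
      by (cases us; cases vs) (auto simp: tensors_def t_def q_R \<epsilon>_mult sub)
  qed (rule that)
  have T: "T (coset 2 (frag_of [x, y])) = \<epsilon> x * q y" if "x \<in> carrier H" "y \<in> carrier H" for x y
    using T_t[of "[x, y]"] that by (simp add: tensors_def t_def)
  have T_l: "T (lsmult (tensor_power H R 2) a X) = \<epsilon> a * T X"
    if "a \<in> carrier H" "X \<in> carrier (tensor_power H R 2)" for X a
    using that(2)
  proof (rule tensor_power_additive_eqI[rotated 3])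
    fix xs assume "xs \<in> tensors 2"
    then obtain x y where xs: "xs = [x, y]" "x \<in> carrier H" "y \<in> carrier H"
      by (rule tensors_2_cases)
    have "lsmult (tensor_power H R 2) a (coset 2 (frag_of [x, y])) = coset 2 (frag_of [a \<otimes> x, y])"
      using that(1) lsmult_pure[of a 1 x "[y]"] by (simp add: numeral_2_eq_2)
    then show "T (lsmult (tensor_power H R 2) a (coset 2 (frag_of xs))) = \<epsilon> a * T (coset 2 (frag_of xs))"
      using that(1) xs by (simp add: T \<epsilon>_mult)
  qed (use that(1) in \<open>simp_all add: M.lsmult_add M.lsmult_closed T_add distrib_left\<close>)
  have h1: "coset 2 (frag_of [\<one>, h]) \<in> carrier (tensor_power H R 2)"
    using pure_closed[of "[\<one>, h]" 2] rh by (simp add: tensors_def numeral_2_eq_2)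
  have "T (rsmult (tensor_power H R 2) (coset 2 (frag_of [\<one>, h])) r) = T (coset 2 (frag_of [\<one>, h])) * \<epsilon> r"
  proof (rule summand_of_power_additive_eqI[OF M MN, where m = "coset 2 (frag_of [\<one>, h])"])
    fix \<psi> n assume \<psi>: "\<psi> \<in> bimodule_hom (carrier H) R (tensor_power H R 1) (tensor_power H R 2)"
      and "n \<in> carrier (tensor_power H R 1)"
    then obtain b where b: "b \<in> carrier H" "n = coset 1 (frag_of [b])"
      by (blast elim: tensor_power_1_cases)
    let ?e = "coset 1 (frag_of [\<one>])"
    have e: "?e \<in> carrier (tensor_power H R 1)"
      using pure_closed[of "[\<one>]" 1] by (simp add: tensors_def)
    have cyc: "coset 1 (frag_of [c]) = lsmult (tensor_power H R 1) c ?e" if "c \<in> carrier H" for c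
      using that lsmult_pure[of c 0 \<one> "[]"] by simp
    \<comment> \<open>The right action of \<open>r\<close> on the multiple of the generator by
      \<open>b\<close> is turned into left multiplication by \<open>b \<otimes> r\<close>, which
      \<open>\<psi>\<close> carries along and \<open>T\<close> converts into a scalar.\<close>
    have n: "n \<in> carrier (tensor_power H R 1)" "n = lsmult (tensor_power H R 1) b ?e"
      "rsmult (tensor_power H R 1) n r = lsmult (tensor_power H R 1) (b \<otimes> r) ?e"
      using b rh pure_closed[of "[b]" 1] rsmult_pure[of r 0 "[]" b] cyc[of b] cyc[of "b \<otimes> r"]
      by (simp_all add: tensors_def sub)
    note h = bimodule_homD[OF \<psi>]
    have "T (\<psi> (rsmult (tensor_power H R 1) n r)) = \<epsilon> b * \<epsilon> r * T (\<psi> ?e)"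
      unfolding n(3) using b e rh by (simp add: h[unfolded One_nat_def] T_l \<epsilon>_mult sub)
    moreover have "T (\<psi> n) = \<epsilon> b * T (\<psi> ?e)"
      unfolding n(2) using b e by (simp add: h[unfolded One_nat_def] T_l)
    ultimately show "T (rsmult (tensor_power H R 2) (\<psi> n) r) = T (\<psi> n) * \<epsilon> r"
      using h(4)[OF rh(1) n(1)] by (simp add: algebra_simps)
  qed (use rh in \<open>auto simp: sub M.rsmult_add M.rsmult_closed T_add h1 distrib_right\<close>)
  then show ?thesis using rh rsmult_pure[of r 1 "[\<one>]" h]
    by (simp add: sub T[unfolded numeral_2_eq_2] \<epsilon>_one numeral_2_eq_2)
qed

section \<open>A sufficient criterion for depth 1\<close>

text \<open>The two halves of similarity: \<open>f\<close> and \<open>g\<close> make the ring a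
  retract of a power of \<open>R\<close>, and \<open>s\<close> splits the inclusion of
  \<open>R\<close>. The isomorphism \<open>c\<close> carries both to the tensor power with one
  factor.\<close>

lemma odd_depth_0I:
  assumes f: "f \<in> bimodule_hom R R (mult_bimodule H (carrier H)) (bimodule_power (mult_bimodule H R) p)"
    and g: "g \<in> bimodule_hom R R (bimodule_power (mult_bimodule H R) p) (mult_bimodule H (carrier H))"
    and gf: "\<And>x. x \<in> carrier H \<Longrightarrow> g (f x) = x" and p: "p > 0"
    and s: "s \<in> bimodule_hom R R (mult_bimodule H (carrier H)) (mult_bimodule H R)"
    and sR: "\<And>r. r \<in> R \<Longrightarrow> s r = r"
  shows "odd_depth H R 0"
proof -
  let ?HH = "mult_bimodule H (carrier H)" and ?RR = "mult_bimodule H R" and ?T = "tensor_power H R 1"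
  define c where "c x = coset 1 (frag_of [x])" for x
  have M: "bimodule_on R R ?T"
    by (rule bimodule_on_mono[OF tensor_power_bimodule]) (use R_subset in auto)
  note N = mult_bimodule_bimodule[OF R_subring]
  have HH: "bimodule_on R R ?HH"
    by (rule bimodule_on_mono[OF mult_bimodule_bimodule[OF carrier_is_subring] R_subset R_subset])
  have c: "c \<in> bimodule_iso R R ?HH ?T"
    using tensor_power_1_iso' R_subset unfolding c_def bimodule_iso_def by blast
  define d where "d = inv_into (carrier H) c"
  have d: "d \<in> bimodule_hom R R ?T ?HH"
    using bimodule_iso_inv_hom[OF HH c] by (simp add: d_def mult_bimodule_def)
  have bij: "bij_betw c (carrier H) (carrier ?T)"
    using c by (simp add: bimodule_iso_def mult_bimodule_def)
  have dc: "d (c x) = x" if "x \<in> carrier H" for x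
    using bij_betw_inv_into_left[OF bij that] by (simp add: d_def)
  have cd: "c (d X) = X" if "X \<in> carrier ?T" for X
    using bij_betw_inv_into_right[OF bij that] by (simp add: d_def)
  note c_hom = bimodule_iso_imp_hom[OF c]
  have "iso_to_summand_of_power R R ?T ?RR p"
  proof (rule retract_imp_iso_to_summand_of_power[OF M N])
    show "f \<circ> d \<in> bimodule_hom R R ?T (bimodule_power ?RR p)"
      by (rule bimodule_hom_comp[OF d f])
    show "c \<circ> g \<in> bimodule_hom R R (bimodule_power ?RR p) ?T"
      by (rule bimodule_hom_comp[OF g c_hom])
    show "(c \<circ> g) ((f \<circ> d) X) = X" if "X \<in> carrier ?T" for X
      using that bimodule_homD(1)[OF d that] by (simp add: gf cd mult_bimodule_def)
  qed
  moreover have "iso_to_summand_of_power R R ?RR ?T 1"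
  proof (rule retract_imp_iso_to_summand_of_power[OF N M])
    have sub: "x \<in> carrier H" if "x \<in> R" for x using R_subset that by blast
    have "id \<in> bimodule_hom R R ?RR ?HH"
      by (auto simp: bimodule_hom_def mult_bimodule_def sub)
    \<comment> \<open>The first power is still a set of functions, on \<open>{..<1}\<close>:
      constant functions lead into it, and evaluation at 0 leads back.\<close>
    moreover have "(\<lambda>x. \<lambda>i\<in>{..<1}. x) \<in> bimodule_hom R R ?T (bimodule_power ?T 1)"
      by (auto simp: bimodule_hom_def bimodule_power_def intro!: restrict_ext)
    ultimately show "(\<lambda>x. \<lambda>i\<in>{..<1}. x) \<circ> (c \<circ> id) \<in> bimodule_hom R R ?RR (bimodule_power ?T 1)"
      by (intro bimodule_hom_comp[OF bimodule_hom_comp[OF _ c_hom]])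
    have "(\<lambda>x. x 0) \<in> bimodule_hom R R (bimodule_power ?T 1) ?T"
      unfolding bimodule_hom_def bimodule_power_def by auto
    then show "s \<circ> d \<circ> (\<lambda>x. x 0) \<in> bimodule_hom R R (bimodule_power ?T 1) ?RR"
      by (rule bimodule_hom_comp[OF _ bimodule_hom_comp[OF d s]])
    show "(s \<circ> d \<circ> (\<lambda>x. x 0)) (((\<lambda>x. \<lambda>i\<in>{..<1::nat}. x) \<circ> (c \<circ> id)) r) = r" if "r \<in> carrier ?RR" for r
      using that sub by (simp add: dc sR mult_bimodule_def)
  qed
  ultimately show ?thesis
    using p unfolding odd_depth_def similar_def by auto
qed

end

section \<open>Minimum depth at most 2 in terms of individual depths\<close>

text \<open>Depth 1 is the odd case with parameter 0, and depth 2 is the even case with parameter 1.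
  If neither occurs, all depths are at least 3; the infimum is then at least 3 as well, even when
  there are no depths and it is infinite.\<close>

lemma min_depth_le_2_iff: "min_depth R H \<le> 2 \<longleftrightarrow> odd_depth H R 0 \<or> even_depth H R 1"
proof -
  have 1: "has_depth H R 1 \<longleftrightarrow> odd_depth H R 0"
    by (auto simp: has_depth_def)
  have 2: "has_depth H R 2 \<longleftrightarrow> even_depth H R 1"
  proof -
    have "2 \<noteq> 2 * n + 1" for n :: nat by presburger
    then show ?thesis by (auto simp: has_depth_def)
  qed
  show ?thesis
  proof
    assume le: "min_depth R H \<le> 2"
    show "odd_depth H R 0 \<or> even_depth H R 1"
    proof (rule ccontr)
      assume "\<not> ?thesis"
      then have "\<not> has_depth H R 1" "\<not> has_depth H R 2" using 1 2 by auto
      then have "3 \<le> m" if "m > 0" "has_depth H R m" for m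
        using that by (cases "m = 1 \<or> m = 2") auto
      then have "(3::enat) \<le> min_depth R H"
        unfolding min_depth_def
        by (intro INF_greatest) (auto simp: numeral_eq_enat)
      with le have "(3::enat) \<le> 2" by (rule order_trans[rotated])
      then show False by (simp add: numeral_eq_enat)
    qed
  next
    assume "odd_depth H R 0 \<or> even_depth H R 1"
    with 1 2 have "has_depth H R 1 \<or> has_depth H R 2" by blast
    then obtain m :: nat where "m > 0" "has_depth H R m" "m \<le> 2"
      by (elim disjE) (rule that[of 1] that[of 2]; simp)+
    then show "min_depth R H \<le> 2"
      unfolding min_depth_def
      by (intro INF_lower2[of m]) (auto simp: numeral_eq_enat)
  qed
qed


section \<open>The double of a group algebra\<close>

context group
begin

text \<open>
  The class of \<open>a\<close> in \<open>D / D R\<^sup>+\<close> is \<open>\<Sum> slice_sum a z \<cdot> [p\<^sub>z]\<close>, because \<open>p\<^sub>z \<bowtie> g\<close> is congruent to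
  \<open>p\<^sub>z\<close>; its class in \<open>D / R\<^sup>+ D\<close> is \<open>\<Sum> conj_sum a y \<cdot> [p\<^sub>y]\<close>, because
  \<open>p\<^bsub>g y g\<inverse>\<^esub> \<bowtie> g = g p\<^sub>y\<close>. The value at \<open>\<one>\<close> of either one is the counit.
\<close>

definition slice_sum :: "('a \<times> 'a \<Rightarrow> 'k::field) \<Rightarrow> 'a \<Rightarrow> 'k" where
  "slice_sum a z = (\<Sum>g\<in>carrier G. a (z, g))"

definition conj_sum :: "('a \<times> 'a \<Rightarrow> 'k::field) \<Rightarrow> 'a \<Rightarrow> 'k" where
  "conj_sum a y = (\<Sum>g\<in>carrier G. a (g \<otimes> y \<otimes> inv g, g))"

section \<open>Calculation rules for the two quotients of the double\<close>

lemma double_add_coord: "(a \<oplus>\<^bsub>drinfeld_double (k :: 'k::field itself) G\<^esub> b) u = a u + b u"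
  by (cases u) (simp add: drinfeld_double_def)

lemma slice_sum_add:
  "slice_sum (a \<oplus>\<^bsub>drinfeld_double (k :: 'k::field itself) G\<^esub> b) z = slice_sum a z + slice_sum b z"
  by (simp add: slice_sum_def double_add_coord sum.distrib)

lemma conj_sum_add:
  "conj_sum (a \<oplus>\<^bsub>drinfeld_double (k :: 'k::field itself) G\<^esub> b) z = conj_sum a z + conj_sum b z"
  by (simp add: conj_sum_def double_add_coord sum.distrib)

lemma sum_left_translate:
  assumes "g \<in> carrier G"
  shows "(\<Sum>w\<in>carrier G. f (inv g \<otimes> w)) = (\<Sum>w\<in>carrier G. f w)"
  by (rule sum.reindex_bij_witness[of _ "\<lambda>w. g \<otimes> w" "\<lambda>w. inv g \<otimes> w"])
     (use assms in \<open>auto simp: m_assoc[symmetric]\<close>)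

text \<open>The left module structure of \<open>D / D R\<^sup>+\<close>: the element
  \<open>p\<^sub>z \<bowtie> g\<close> sends the class of \<open>p\<^sub>y\<close> to that of
  \<open>p\<^sub>z\<close> if \<open>z = g y g\<inverse>\<close>, and to zero otherwise. In
  coordinates this is a translation of the summation index.\<close>

lemma slice_sum_mult:
  assumes fin: "finite (carrier G)" and z: "z \<in> carrier G"
  shows "slice_sum (a \<otimes>\<^bsub>drinfeld_double (k :: 'k::field itself) G\<^esub> b) z =
    (\<Sum>g\<in>carrier G. a (z, g) * slice_sum b (inv g \<otimes> z \<otimes> g))"
proof -
  have "slice_sum (a \<otimes>\<^bsub>drinfeld_double k G\<^esub> b) z =
    (\<Sum>w\<in>carrier G. \<Sum>g\<in>carrier G. a (z, g) * b (inv g \<otimes> z \<otimes> g, inv g \<otimes> w))"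
    using z by (simp add: slice_sum_def double_mult_coord[OF fin] cong: sum.cong)
  also have "\<dots> = (\<Sum>g\<in>carrier G. a (z, g) * (\<Sum>w\<in>carrier G. b (inv g \<otimes> z \<otimes> g, inv g \<otimes> w)))"
    by (subst sum.swap) (simp add: sum_distrib_left)
  also have "\<dots> = (\<Sum>g\<in>carrier G. a (z, g) * slice_sum b (inv g \<otimes> z \<otimes> g))"
    by (intro sum.cong refl)
       (simp add: slice_sum_def sum_left_translate[where f = "\<lambda>w. b (z', w)" for z'])
  finally show ?thesis .
qed

text \<open>The assumption on \<open>r\<close> describes elements of \<open>kG\<close>, whose
  coefficients agree on all \<open>p\<^sub>z\<close>; their counit is
  \<open>slice_sum r \<one>\<close>. Replacing \<open>g\<close> by \<open>inv h \<otimes> g\<close>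
  reassembles the conjugate, so \<open>r\<close> acts by its counit, as it must on
  \<open>D / R\<^sup>+ D\<close>.\<close>

lemma conj_sum_mult_left:
  assumes fin: "finite (carrier G)" and y: "y \<in> carrier G"
    and r: "\<And>z w. z \<in> carrier G \<Longrightarrow> r (z, w) = r (\<one>, w)"
  shows "conj_sum (r \<otimes>\<^bsub>drinfeld_double (k :: 'k::field itself) G\<^esub> a) y = slice_sum r \<one> * conj_sum a y"
proof -
  have "conj_sum (r \<otimes>\<^bsub>drinfeld_double k G\<^esub> a) y = (\<Sum>g\<in>carrier G. \<Sum>h\<in>carrier G.
      r (\<one>, h) * a (inv h \<otimes> (g \<otimes> y \<otimes> inv g) \<otimes> h, inv h \<otimes> g))"
    using y by (simp add: conj_sum_def double_mult_coord[OF fin] r[of "g \<otimes> y \<otimes> inv g" for g] cong: sum.cong)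
  also have "\<dots> = (\<Sum>g\<in>carrier G. \<Sum>h\<in>carrier G.
      r (\<one>, h) * a ((inv h \<otimes> g) \<otimes> y \<otimes> inv (inv h \<otimes> g), inv h \<otimes> g))"
    using y by (intro sum.cong refl) (simp add: inv_mult_group m_assoc)
  also have "\<dots> = (\<Sum>h\<in>carrier G. r (\<one>, h) *
      (\<Sum>g\<in>carrier G. a ((inv h \<otimes> g) \<otimes> y \<otimes> inv (inv h \<otimes> g), inv h \<otimes> g)))"
    by (subst sum.swap) (simp add: sum_distrib_left)
  also have "\<dots> = (\<Sum>h\<in>carrier G. r (\<one>, h) * conj_sum a y)"
    by (intro sum.cong refl)
       (simp add: conj_sum_def sum_left_translate[where f = "\<lambda>w. a (w \<otimes> y \<otimes> inv w, w)"])
  finally show ?thesis by (simp add: slice_sum_def sum_distrib_right)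
qed

lemma group_algebra_in_double_coord:
  "r \<in> group_algebra_in_double (k :: 'k::field itself) G \<Longrightarrow> z \<in> carrier G \<Longrightarrow> r (z, w) = r (\<one>, w)"
  by (auto simp: group_algebra_in_double_def group_algebra_embed_def)

lemma comm_group_if_conj_trivial:
  assumes "\<And>y g. y \<in> carrier G \<Longrightarrow> g \<in> carrier G \<Longrightarrow> g \<otimes> y \<otimes> inv g = y"
  shows "comm_group G"
proof (rule group_comm_groupI)
  fix x y assume "x \<in> carrier G" "y \<in> carrier G"
  then show "x \<otimes> y = y \<otimes> x"
    using assms[of y x] by (metis inv_solve_right' m_closed)
qed

section \<open>Small depth forces commutativity\<close>

text \<open>The functionals are the coordinates of \<open>D / D R\<^sup>+\<close>, or those of
  \<open>D / R\<^sup>+ D\<close> in the right-handed case. They are tested on a group element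
  \<open>g\<close> and a basis element \<open>p\<^sub>y\<close>, where coordinate \<open>y\<close>
  alone detects whether conjugation by \<open>g\<close> fixes \<open>y\<close>.\<close>

lemma double_depth_imp_comm:
  fixes k :: "'k::field itself"
  assumes fin: "finite (carrier G)"
    and depth: "odd_depth (drinfeld_double k G) (group_algebra_in_double k G) 0 \<or>
      even_depth (drinfeld_double k G) (group_algebra_in_double k G) 1"
  shows "comm_group G"
proof (rule comm_group_if_conj_trivial)
  define D where "D = drinfeld_double k G"
  define R where "R = group_algebra_in_double k G"
  interpret D: tensor_ring D R
    unfolding D_def R_def tensor_ring_def tensor_ring_axioms_def
    using double_ring[OF fin] group_algebra_in_double_subring[OF fin] by blast
  let ?\<epsilon> = "\<lambda>a. slice_sum a \<one>"
  fix y g assume yg: "y \<in> carrier G" "g \<in> carrier G"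
  let ?p = "\<lambda>x g u. of_bool (u = (x, g)) :: 'k"
  define r where "r = group_algebra_embed G (\<lambda>w. of_bool (w = g) :: 'k)"
  have r_coord: "r (z, w) = of_bool (z \<in> carrier G \<and> w = g)" for z w
    by (simp add: r_def group_algebra_embed_def)
  have rR: "r \<in> R"
    using yg by (auto simp: r_def R_def group_algebra_in_double_def group_algebra_def)
  have pD: "?p y \<one> \<in> carrier D" using yg by (auto simp: D_def drinfeld_double_def)
  \<comment> \<open>Conjugation fixes the identity, so at \<open>\<one>\<close> the sum in
    \<open>slice_sum_mult\<close> factors.\<close>
  have \<epsilon>_mult: "?\<epsilon> (a \<otimes>\<^bsub>D\<^esub> b) = ?\<epsilon> a * ?\<epsilon> b" for a b
    by (simp add: D_def slice_sum_mult[OF fin]) (simp add: slice_sum_def sum_distrib_right)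
  have \<epsilon>_one: "?\<epsilon> \<one>\<^bsub>D\<^esub> = 1"
    using fin by (simp add: slice_sum_def D_def drinfeld_double_def of_bool_def)
  have \<epsilon>_r: "?\<epsilon> r = 1"
    using fin yg by (simp add: slice_sum_def r_coord of_bool_def)
  \<comment> \<open>All slices of an element of \<open>R\<close> have the same sum, namely its
    counit, so it can be taken out of the sum.\<close>
  have slice_R: "slice_sum (a \<otimes>\<^bsub>D\<^esub> b) z = slice_sum a z * ?\<epsilon> b" if "b \<in> R" "z \<in> carrier G" for a b z
  proof -
    have eq: "slice_sum b z' = ?\<epsilon> b" if "z' \<in> carrier G" for z'
      using group_algebra_in_double_coord[of b k z'] that \<open>b \<in> R\<close> by (simp add: slice_sum_def R_def)
    have "slice_sum (a \<otimes>\<^bsub>D\<^esub> b) z = (\<Sum>h\<in>carrier G. a (z, h) * ?\<epsilon> b)"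
      unfolding D_def slice_sum_mult[OF fin that(2)] by (intro sum.cong refl arg_cong2[where f = "(*)"] eq) (use that in simp)
    then show ?thesis by (simp add: slice_sum_def[of a] sum_distrib_right)
  qed
  have conj_R: "conj_sum (b \<otimes>\<^bsub>D\<^esub> a) z = ?\<epsilon> b * conj_sum a z" if "b \<in> R" "z \<in> carrier G" for a b z
    unfolding D_def
    by (rule conj_sum_mult_left[OF fin that(2)])
       (rule group_algebra_in_double_coord, use that in \<open>simp_all add: R_def\<close>)
  have from_slice: "g \<otimes> y \<otimes> inv g = y"
    if "\<And>z. z \<in> carrier G \<Longrightarrow> slice_sum (r \<otimes>\<^bsub>D\<^esub> ?p y \<one>) z = ?\<epsilon> r * slice_sum (?p y \<one>) z"
  proof -
    have "slice_sum (?p y \<one>) z = of_bool (z = y)" for z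
      using fin by (auto simp: slice_sum_def of_bool_def intro!: sum.neutral)
    then have "(\<Sum>h\<in>carrier G. r (y, h) * of_bool (inv h \<otimes> y \<otimes> h = y)) = 1"
      using that[of y] yg \<epsilon>_r by (simp add: D_def slice_sum_mult[OF fin])
    moreover have "(\<Sum>h\<in>carrier G. r (y, h) * of_bool (inv h \<otimes> y \<otimes> h = y)) =
        (\<Sum>h\<in>carrier G. if h = g then of_bool (inv g \<otimes> y \<otimes> g = y) else 0)"
      by (rule sum.cong) (auto simp: r_coord yg)
    ultimately have "inv g \<otimes> y \<otimes> g = y"
      using fin yg by (simp split: if_splits)
    then show ?thesis using yg
      by (metis inv_closed inv_solve_left inv_solve_right' m_assoc m_closed)
  qed
  \<comment> \<open>On the other side, \<open>p\<^sub>y g\<close> equals \<open>g\<close> times the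
    basis element at \<open>inv g \<otimes> y \<otimes> g\<close>, and coordinate \<open>y\<close>
    is compared again.\<close>
  have from_conj: "g \<otimes> y \<otimes> inv g = y"
    if "\<And>z. z \<in> carrier G \<Longrightarrow> conj_sum (?p y \<one> \<otimes>\<^bsub>D\<^esub> r) z = conj_sum (?p y \<one>) z * ?\<epsilon> r"
  proof -
    have prod: "(?p y \<one> \<otimes>\<^bsub>D\<^esub> r) (z, w) = of_bool (z = y \<and> w = g)"
      if "z \<in> carrier G" "w \<in> carrier G" for z w
    proof -
      have "(?p y \<one> \<otimes>\<^bsub>D\<^esub> r) (z, w) = (\<Sum>h\<in>carrier G. if h = \<one> then of_bool (z = y \<and> w = g) else 0)"
        unfolding D_def double_mult_coord[OF fin that]
        by (rule sum.cong) (use that yg in \<open>auto simp: r_coord\<close>)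
      then show ?thesis using fin by simp
    qed
    have "conj_sum (?p y \<one>) y = (\<Sum>h\<in>carrier G. if h = \<one> then 1 else 0)"
      unfolding conj_sum_def by (rule sum.cong) (use yg in auto)
    then have "conj_sum (?p y \<one> \<otimes>\<^bsub>D\<^esub> r) y = 1"
      using that[of y] yg fin \<epsilon>_r by simp
    moreover have "conj_sum (?p y \<one> \<otimes>\<^bsub>D\<^esub> r) y =
        (\<Sum>h\<in>carrier G. if h = g then of_bool (g \<otimes> y \<otimes> inv g = y) else 0)"
      unfolding conj_sum_def by (rule sum.cong) (use yg in \<open>auto simp: prod\<close>)
    ultimately show ?thesis
      using fin yg by (simp split: if_splits)
  qed
  note add = slice_sum_add[of k, folded D_def] conj_sum_add[of k, folded D_def]
  from depth consider
    (one) p where "iso_to_summand_of_power R R (tensor_power D R 1) (mult_bimodule D R) p"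
  | (left) p where "iso_to_summand_of_power R (carrier D) (tensor_power D R 2) (tensor_power D R 1) p"
  | (right) p where "iso_to_summand_of_power (carrier D) R (tensor_power D R 2) (tensor_power D R 1) p"
    by (auto simp: odd_depth_def even_depth_def similar_def numeral_2_eq_2 simp flip: D_def R_def)
  then show "g \<otimes> y \<otimes> inv g = y"
  proof cases
    case one
    show ?thesis
      by (rule from_slice, rule D.depth_1_functional[OF one, where \<epsilon> = ?\<epsilon>])
         (use \<epsilon>_mult add slice_R rR pD in auto)
  next
    case left
    show ?thesis
      by (rule from_slice, rule D.depth_2_left_functional[OF left, where \<epsilon> = ?\<epsilon>])
         (use \<epsilon>_mult \<epsilon>_one add slice_R rR pD in auto)
  next
    case right
    show ?thesis
      by (rule from_conj, rule D.depth_2_right_functional[OF right, where \<epsilon> = ?\<epsilon> and q = "\<lambda>a. conj_sum a z" for z])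
         (use \<epsilon>_mult \<epsilon>_one add conj_R rR pD in auto)
  qed
qed

section \<open>Commutativity gives depth 1\<close>

text \<open>Once conjugation is trivial, the product is a convolution in the second coordinate for
  each fixed first coordinate. Cutting into slices therefore identifies the double with a power of
  \<open>R\<close> of exponent \<open>card (carrier G)\<close>, and a single slice retracts the
  double onto \<open>R\<close>.\<close>

lemma double_odd_depth_0_if_comm:
  fixes k :: "'k::field itself"
  assumes "comm_group G" and fin: "finite (carrier G)"
  shows "odd_depth (drinfeld_double k G) (group_algebra_in_double k G) 0"
proof -
  interpret comm_group G by fact
  define D where "D = drinfeld_double k G"
  define R where "R = group_algebra_in_double k G"
  interpret D: tensor_ring D R
    unfolding D_def R_def tensor_ring_def tensor_ring_axioms_def
    using double_ring[OF fin] group_algebra_in_double_subring[OF fin] by blast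
  have D_carrier: "a \<in> carrier D \<longleftrightarrow> (\<forall>x g. x \<notin> carrier G \<or> g \<notin> carrier G \<longrightarrow> a (x, g) = 0)" for a
    by (simp add: D_def drinfeld_double_def)
  have D_add: "(a \<oplus>\<^bsub>D\<^esub> b) u = a u + b u" for a b u
    by (simp add: D_def double_add_coord)
  have conj: "inv g \<otimes> z \<otimes> g = z" if "z \<in> carrier G" "g \<in> carrier G" for z g
    using that by (metis inv_closed l_inv m_assoc m_comm r_one)
  have mult: "(a \<otimes>\<^bsub>D\<^esub> b) (z, w) = (if z \<in> carrier G \<and> w \<in> carrier G
      then \<Sum>g\<in>carrier G. a (z, g) * b (z, inv g \<otimes> w) else 0)" for a b z w
  proof (cases "z \<in> carrier G \<and> w \<in> carrier G")
    case True
    then show ?thesis by (simp add: D_def double_mult_coord[OF fin] conj cong: sum.cong)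
  next
    case False
    then show ?thesis using double_mult_closed[of k a b] by (auto simp: drinfeld_double_def D_def)
  qed
  have R_iff: "r \<in> R \<longleftrightarrow> r \<in> carrier D \<and> (\<exists>c. \<forall>z\<in>carrier G. \<forall>w. r (z, w) = c w)" for r
  proof
    assume r: "r \<in> R"
    show "r \<in> carrier D \<and> (\<exists>c. \<forall>z\<in>carrier G. \<forall>w. r (z, w) = c w)"
    proof (intro conjI exI ballI allI)
      show "r \<in> carrier D" using r D.R_subset by blast
      show "r (z, w) = r (\<one>, w)" if "z \<in> carrier G" for z w
        using r that unfolding R_def by (rule group_algebra_in_double_coord)
    qed
  next
    assume "r \<in> carrier D \<and> (\<exists>c. \<forall>z\<in>carrier G. \<forall>w. r (z, w) = c w)"
    then obtain c where r: "r \<in> carrier D" "\<And>z w. z \<in> carrier G \<Longrightarrow> r (z, w) = c w" by blast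
    then have "r = group_algebra_embed G c"
      by (auto simp: group_algebra_embed_def D_carrier fun_eq_iff)
    moreover have "c w = 0" if "w \<notin> carrier G" for w
      using r that by (metis D_carrier one_closed)
    then have "c \<in> carrier (group_algebra k G)"
      by (simp add: group_algebra_def)
    ultimately show "r \<in> R" unfolding R_def group_algebra_in_double_def by blast
  qed
  \<comment> \<open>The coefficients of \<open>a\<close> at \<open>z\<close> are copied to every
    first coordinate, which gives an element of \<open>R\<close>.\<close>
  define slice where "slice z a = (\<lambda>(y, w). of_bool (y \<in> carrier G) * a (z, w))"
    for z and a :: "'a \<times> 'a \<Rightarrow> 'k"
  have slice_R: "slice z a \<in> R" if "a \<in> carrier D" "z \<in> carrier G" for z a
    using that by (auto simp: R_iff D_carrier slice_def)
  have slice_id: "slice z r = r" if "r \<in> R" "z \<in> carrier G" for z r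
    using that by (auto simp: R_iff D_carrier slice_def fun_eq_iff)
  have slice_add: "slice z (a \<oplus>\<^bsub>D\<^esub> b) = slice z a \<oplus>\<^bsub>D\<^esub> slice z b" for z a b
    by (auto simp: slice_def D_add fun_eq_iff algebra_simps)
  have slice_mult: "slice z (a \<otimes>\<^bsub>D\<^esub> b) = slice z a \<otimes>\<^bsub>D\<^esub> slice z b" if "z \<in> carrier G" for z a b
    using that by (auto simp: slice_def mult fun_eq_iff)
  \<comment> \<open>A multiplicative map that fixes \<open>R\<close> pointwise is linear over
    \<open>R\<close> on both sides.\<close>
  have slice_hom: "slice z \<in> bimodule_hom R R (mult_bimodule D (carrier D)) (mult_bimodule D R)"
    if "z \<in> carrier G" for z
    using that by (auto simp: bimodule_hom_def mult_bimodule_def slice_R slice_add slice_mult slice_id)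
  \<comment> \<open>Powers are indexed by initial segments of the naturals, so the group has to be
    enumerated; \<open>idx\<close> is the inverse enumeration.\<close>
  obtain e where e: "bij_betw e {..<card (carrier G)} (carrier G)"
    using ex_bij_betw_nat_finite[OF fin] by (auto simp: atLeast0LessThan)
  define n where "n = card (carrier G)"
  have en: "e i \<in> carrier G" if "i < n" for i
    using e that by (auto simp: bij_betw_def n_def)
  define idx where "idx = inv_into {..<n} e"
  have idx: "idx z < n" "e (idx z) = z" if "z \<in> carrier G" for z
    using e that by (auto simp: idx_def n_def bij_betw_def inv_into_into[of z e "{..<card (carrier G)}", simplified]
        f_inv_into_f)
  \<comment> \<open>The inverse of cutting into slices: the coefficients at \<open>z\<close> are
    read off the component whose index belongs to \<open>z\<close>.\<close>
  define glue where "glue x = (\<lambda>(z, w). of_bool (z \<in> carrier G) * x (idx z) (z, w))"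
    for x :: "nat \<Rightarrow> 'a \<times> 'a \<Rightarrow> 'k"
  let ?RR = "mult_bimodule D R" and ?DD = "mult_bimodule D (carrier D)"
  have power_R: "x i \<in> R" if "x \<in> carrier (bimodule_power ?RR n)" "i < n" for x i
    using that by (auto simp: bimodule_power_def mult_bimodule_def)
  have "odd_depth D R 0"
  proof (rule D.odd_depth_0I)
    show "(\<lambda>a. \<lambda>i\<in>{..<n}. slice (e i) a) \<in> bimodule_hom R R ?DD (bimodule_power ?RR n)"
      using bimodule_homD[OF slice_hom[OF en]]
      by (auto simp: bimodule_hom_def bimodule_power_def mult_bimodule_def intro!: restrict_ext)
    show "glue \<in> bimodule_hom R R (bimodule_power ?RR n) ?DD"
      unfolding bimodule_hom_def
    proof (intro CollectI conjI ballI funcsetI)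
      fix x assume x: "x \<in> carrier (bimodule_power ?RR n)"
      show "glue x \<in> carrier ?DD"
        using power_R[OF x idx(1)] by (auto simp: mult_bimodule_def D_carrier glue_def R_iff)
      show "glue (x \<oplus>\<^bsub>bimodule_power ?RR n\<^esub> y) = glue x \<oplus>\<^bsub>?DD\<^esub> glue y" for y
        by (auto simp: glue_def mult_bimodule_def bimodule_power_def fun_eq_iff D_add idx)
      show "glue (lsmult (bimodule_power ?RR n) r x) = lsmult ?DD r (glue x)" for r
        by (auto simp: glue_def mult_bimodule_def bimodule_power_def fun_eq_iff mult idx)
      show "glue (rsmult (bimodule_power ?RR n) x r) = rsmult ?DD (glue x) r" for r
        by (auto simp: glue_def mult_bimodule_def bimodule_power_def fun_eq_iff mult idx)
    qed
    show "glue (\<lambda>i\<in>{..<n}. slice (e i) a) = a" if "a \<in> carrier D" for a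
      using that by (auto simp: glue_def slice_def fun_eq_iff idx D_carrier)
    show "n > 0"
      using idx(1)[OF one_closed] by simp
    show "slice \<one> \<in> bimodule_hom R R ?DD ?RR"
      by (rule slice_hom) simp
    show "slice \<one> r = r" if "r \<in> R" for r
      using that by (simp add: slice_id)
  qed
  then show ?thesis by (simp add: D_def R_def)
qed

end

theorem corollary4p2:
  fixes G :: "('g, 'b) monoid_scheme"
  assumes "group G" and "finite (carrier G)"
  shows "min_depth (group_algebra_in_double TYPE('k::field_char_0) G)
           (drinfeld_double TYPE('k) G) \<le> 2
         \<longleftrightarrow> comm_group G"
  using group.double_depth_imp_comm[OF assms, of "TYPE('k)"]
    group.double_odd_depth_0_if_comm[OF assms(1) _ assms(2), of "TYPE('k)"]
  unfolding min_depth_le_2_iff by blast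

end
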